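(* Let $\mathbb{F}$ be a skew field and $n$ a positive integer. A matroid $M$ has an $n$-multilinear representation over $\mathbb{F}$ if and only if $M$ is representable over the skew partial field $\mathbb{P}(n,\mathbb{F}):=(M(n,\mathbb{F}),\mathrm{GL}(n,\mathbb{F}))$.
   Context: $M(n,\mathbb{F})$ is the ring of $n\times n$ matrices over $\mathbb{F}$ and $\mathrm{GL}(n,\mathbb{F})$ its group of units. An $n$-multilinear representation over $\mathbb{F}$ of a rank-$r$ matroid $M$ is a function $V$ assigning to each $e\in E(M)$ an $n$-dimensional subspace $V(e)$ of the right vector space $\mathbb{F}^{nr}$ such that for all $X\subseteq E(M)$, $\dim\big(\sum_{e\in X}V(e)\big)=n\cdot\operatorname{rank}_M(X)$. A skew partial field is a pair $\mathbb{P}=(R,G)$ with $R$ a (not necessarily commutative) ring with identity and $G$ a subgroup of the units $R^*$ with $-1\in G$. An $R$-chain group on a finite set $E$ is a subset of $R^E$ containing $0$ and closed under componentwise addition and left scalar multiplication. A chain $c$ is elementary in $C$ if $c\ne0$ and no nonzero chain of $C$ has support strictly contained in $\|c\|=\{e:c_e\ne0\}$; $c$ is $G$-primitive if its entries lie in $G\cup\{0\}$. A $\mathbb{P}$-chain group is an $R$-chain group in which every elementary chain equals $rc'$ with $r\in R$, $c'$ a $G$-primitive chain of the group; $M(C)$ is the matroid on $E$ whose cocircuits are supports of elementary chains. $M$ is representable over $\mathbb{P}$ if $M=M(C)$ for some $\mathbb{P}$-chain group $C$ on $E(M)$.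
   Formalization: V(e) is required to be n-dimensional only for elements e that are not loops (a loop gets the zero subspace), since the rank condition at a loop contradicts n-dimensionality and the literal equivalence fails for matroids with loops. *)

theory Defs
  imports "Jordan_Normal_Form.Matrix" "HOL-Library.FuncSet"
begin

section \<open>Matroids\<close>

locale matroid =
  fixes E :: "'e set" and indep :: "'e set \<Rightarrow> bool"
  assumes finite_ground: "finite E"
    and indep_ground: "indep X \<Longrightarrow> X \<subseteq> E"
    and indep_empty: "indep {}"
    and indep_subset: "indep Y \<Longrightarrow> X \<subseteq> Y \<Longrightarrow> indep X"
    and indep_augment:
      "indep X \<Longrightarrow> indep Y \<Longrightarrow> card X < card Y \<Longrightarrow> \<exists>y\<in>Y - X. indep (insert y X)"

definition matroid_rank :: "('e set \<Rightarrow> bool) \<Rightarrow> 'e set \<Rightarrow> nat" where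
  "matroid_rank indep X = Max (card ` {Y. Y \<subseteq> X \<and> indep Y})"

definition matroid_basis :: "'e set \<Rightarrow> ('e set \<Rightarrow> bool) \<Rightarrow> 'e set \<Rightarrow> bool" where
  "matroid_basis E indep B \<longleftrightarrow>
     B \<subseteq> E \<and> indep B \<and> (\<forall>X. B \<subset> X \<and> X \<subseteq> E \<longrightarrow> \<not> indep X)"

definition dual_indep :: "'e set \<Rightarrow> ('e set \<Rightarrow> bool) \<Rightarrow> 'e set \<Rightarrow> bool" where
  "dual_indep E indep X \<longleftrightarrow> (\<exists>B. matroid_basis E indep B \<and> X \<subseteq> E - B)"

definition circuits :: "'e set \<Rightarrow> ('e set \<Rightarrow> bool) \<Rightarrow> 'e set set" where
  "circuits E indep = {D. D \<subseteq> E \<and> \<not> indep D \<and> (\<forall>X. X \<subset> D \<longrightarrow> indep X)}"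

definition cocircuits :: "'e set \<Rightarrow> ('e set \<Rightarrow> bool) \<Rightarrow> 'e set set" where
  "cocircuits E indep = circuits E (dual_indep E indep)"

section \<open>Subspaces of the right vector space of column vectors over a skew field\<close>

definition right_smult_vec :: "'f::division_ring vec \<Rightarrow> 'f \<Rightarrow> 'f vec" where
  "right_smult_vec v a = map_vec (\<lambda>x. x * a) v"

definition right_subspace :: "nat \<Rightarrow> 'f::division_ring vec set \<Rightarrow> bool" where
  "right_subspace m W \<longleftrightarrow>
     W \<subseteq> carrier_vec m \<and> 0\<^sub>v m \<in> W \<and>
     (\<forall>v\<in>W. \<forall>w\<in>W. v + w \<in> W) \<and>
     (\<forall>v\<in>W. \<forall>a. right_smult_vec v a \<in> W)"

text \<open>
  The product \<^term>\<open>mat_of_cols m vs *\<^sub>v c\<close> is the linear combination of the vectors \<^term>\<open>vs\<close>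
  with the coefficients \<^term>\<open>c\<close> on the right: its \<open>i\<close>-th entry is the sum of the
  \<^term>\<open>vs ! j $ i * c $ j\<close> over \<open>j\<close>.
\<close>

definition right_basis :: "nat \<Rightarrow> 'f::division_ring vec set \<Rightarrow> 'f vec list \<Rightarrow> bool" where
  "right_basis m W vs \<longleftrightarrow>
     set vs \<subseteq> carrier_vec m \<and>
     (\<forall>c\<in>carrier_vec (length vs). mat_of_cols m vs *\<^sub>v c = 0\<^sub>v m \<longrightarrow> c = 0\<^sub>v (length vs)) \<and>
     W = {mat_of_cols m vs *\<^sub>v c |c. c \<in> carrier_vec (length vs)}"

definition has_right_dim :: "nat \<Rightarrow> 'f::division_ring vec set \<Rightarrow> nat \<Rightarrow> bool" where
  "has_right_dim m W d \<longleftrightarrow> (\<exists>vs. right_basis m W vs \<and> length vs = d)"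

definition subspace_sum :: "nat \<Rightarrow> ('e \<Rightarrow> 'f::division_ring vec set) \<Rightarrow> 'e set \<Rightarrow> 'f vec set" where
  "subspace_sum m V X = {finsum_vec TYPE('f) m v X |v. v \<in> Pi X V}"

section \<open>Multilinear representations\<close>

text \<open>
  For a loop \<open>e\<close> the rank condition at \<^term>\<open>{e}\<close> forces \<open>V e\<close> to be the zero space, so
  the subspaces are required to be \<open>n\<close>-dimensional only at elements that are not loops. For a
  loopless matroid this is the requirement that every \<open>V e\<close> be \<open>n\<close>-dimensional.
\<close>

definition multilinear_representation ::
    "nat \<Rightarrow> 'e set \<Rightarrow> ('e set \<Rightarrow> bool) \<Rightarrow> ('e \<Rightarrow> 'f::division_ring vec set) \<Rightarrow> bool" where
  "multilinear_representation n E indep V \<longleftrightarrow>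
     (let m = n * matroid_rank indep E in
       (\<forall>e\<in>E. right_subspace m (V e) \<and> (indep {e} \<longrightarrow> has_right_dim m (V e) n)) \<and>
       (\<forall>X. X \<subseteq> E \<longrightarrow> has_right_dim m (subspace_sum m V X) (n * matroid_rank indep X)))"

section \<open>Skew partial fields and chain groups\<close>

type_synonym 'r skew_pfield = "'r ring \<times> 'r set"

definition skew_partial_field :: "'r skew_pfield \<Rightarrow> bool" where
  "skew_partial_field P \<longleftrightarrow>
     (case P of (R, G) \<Rightarrow>
       ring R \<and> subgroup G (units_of R) \<and> \<ominus>\<^bsub>R\<^esub> \<one>\<^bsub>R\<^esub> \<in> G)"

definition zero_chain :: "'r ring \<Rightarrow> 'e set \<Rightarrow> 'e \<Rightarrow> 'r" where
  "zero_chain R E = (\<lambda>e\<in>E. \<zero>\<^bsub>R\<^esub>)"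

definition add_chain :: "'r ring \<Rightarrow> 'e set \<Rightarrow> ('e \<Rightarrow> 'r) \<Rightarrow> ('e \<Rightarrow> 'r) \<Rightarrow> 'e \<Rightarrow> 'r" where
  "add_chain R E c d = (\<lambda>e\<in>E. c e \<oplus>\<^bsub>R\<^esub> d e)"

definition smult_chain :: "'r ring \<Rightarrow> 'e set \<Rightarrow> 'r \<Rightarrow> ('e \<Rightarrow> 'r) \<Rightarrow> 'e \<Rightarrow> 'r" where
  "smult_chain R E r c = (\<lambda>e\<in>E. r \<otimes>\<^bsub>R\<^esub> c e)"

definition chain_support :: "'r ring \<Rightarrow> 'e set \<Rightarrow> ('e \<Rightarrow> 'r) \<Rightarrow> 'e set" where
  "chain_support R E c = {e\<in>E. c e \<noteq> \<zero>\<^bsub>R\<^esub>}"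

definition chain_group :: "'r ring \<Rightarrow> 'e set \<Rightarrow> ('e \<Rightarrow> 'r) set \<Rightarrow> bool" where
  "chain_group R E C \<longleftrightarrow>
     C \<subseteq> (E \<rightarrow>\<^sub>E carrier R) \<and> zero_chain R E \<in> C \<and>
     (\<forall>c\<in>C. \<forall>d\<in>C. add_chain R E c d \<in> C) \<and>
     (\<forall>r\<in>carrier R. \<forall>c\<in>C. smult_chain R E r c \<in> C)"

definition elementary_chain :: "'r ring \<Rightarrow> 'e set \<Rightarrow> ('e \<Rightarrow> 'r) set \<Rightarrow> ('e \<Rightarrow> 'r) \<Rightarrow> bool" where
  "elementary_chain R E C c \<longleftrightarrow>
     c \<in> C \<and> c \<noteq> zero_chain R E \<and>
     \<not> (\<exists>d\<in>C. d \<noteq> zero_chain R E \<and> chain_support R E d \<subset> chain_support R E c)"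

definition primitive_chain :: "'r ring \<Rightarrow> 'r set \<Rightarrow> 'e set \<Rightarrow> ('e \<Rightarrow> 'r) \<Rightarrow> bool" where
  "primitive_chain R G E c \<longleftrightarrow> c \<in> (E \<rightarrow>\<^sub>E G \<union> {\<zero>\<^bsub>R\<^esub>})"

definition pfield_chain_group :: "'r skew_pfield \<Rightarrow> 'e set \<Rightarrow> ('e \<Rightarrow> 'r) set \<Rightarrow> bool" where
  "pfield_chain_group P E C \<longleftrightarrow>
     (case P of (R, G) \<Rightarrow>
       chain_group R E C \<and>
       (\<forall>c. elementary_chain R E C c \<longrightarrow>
         (\<exists>r\<in>carrier R. \<exists>c'\<in>C. primitive_chain R G E c' \<and> c = smult_chain R E r c')))"

text \<open>
  A matroid is determined by its ground set and its cocircuits, so for a matroid \<open>M\<close> on \<open>E\<close> the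
  equality \<open>M = M(C)\<close> is the equality of the cocircuits of \<open>M\<close> with the supports of the
  elementary chains of \<open>C\<close>.
\<close>

definition matroid_of_chain_group ::
    "'r skew_pfield \<Rightarrow> 'e set \<Rightarrow> ('e \<Rightarrow> 'r) set \<Rightarrow> ('e set \<Rightarrow> bool) \<Rightarrow> bool" where
  "matroid_of_chain_group P E C indep \<longleftrightarrow>
     matroid E indep \<and>
     cocircuits E indep = chain_support (fst P) E ` {c. elementary_chain (fst P) E C c}"

definition representable_over :: "'e set \<Rightarrow> ('e set \<Rightarrow> bool) \<Rightarrow> 'r skew_pfield \<Rightarrow> bool" where
  "representable_over E indep P \<longleftrightarrow>
     (\<exists>C. pfield_chain_group P E C \<and> matroid_of_chain_group P E C indep)"

definition matrix_skew_pfield :: "'f::division_ring itself \<Rightarrow> nat \<Rightarrow> 'f mat skew_pfield" where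
  "matrix_skew_pfield ty n = (ring_mat ty n (), Units (ring_mat ty n ()))"

lemma ring_mat_division_ring: "ring (ring_mat TYPE('f::division_ring) n b)"
  by (unfold_locales, insert add_inv_exists_mat,
      auto simp: ring_mat_def algebra_simps Units_def)

lemma skew_partial_field_matrix: "skew_partial_field (matrix_skew_pfield TYPE('f::division_ring) n)"
proof -
  interpret R: ring "ring_mat TYPE('f) n ()" by (rule ring_mat_division_ring)
  have "subgroup (Units (ring_mat TYPE('f) n ())) (units_of (ring_mat TYPE('f) n ()))"
    using group.subgroup_self[OF R.units_group] by (simp add: units_of_carrier)
  then show ?thesis
    unfolding skew_partial_field_def matrix_skew_pfield_def
    using R.ring_axioms R.Units_minus_one_closed by simp
qed

end

theory Submission
  imports Defs
begin

text \<open>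
  Both kinds of representation amount to a left \<open>F\<close>-space \<open>U\<close> of functions on
  \<^term>\<open>E \<times> {..<n}\<close> such that functions on \<^term>\<open>B \<times> {..<n}\<close> extend to members of \<open>U\<close>
  whenever \<open>B\<close> is independent, and a member of \<open>U\<close> that vanishes on \<^term>\<open>B \<times> {..<n}\<close> also
  vanishes on the block of every element spanned by \<open>B\<close>. Given subspaces \<open>V e\<close>, write bases of
  them as the columns of a block matrix and let \<open>U\<close> be its row space; conversely the columns of a
  matrix whose rows are a basis of \<open>U\<close>, dual to a basis of the matroid, span the \<open>V e\<close>.

  A chain group over the matrix ring consists of the chains whose rows lie in \<open>U\<close>, as
  multiplication by elementary matrices shows. The two conditions on \<open>U\<close> say that chains can be
  prescribed on independent sets and are determined on their closures. For a chain group over any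
  nontrivial ring with all units allowed this is equivalent to representing the matroid: a
  fundamental cocircuit carries a chain that is \<open>1\<close> at one element of a basis and \<open>0\<close> at the others,
  and exchanging that element for another one of the cocircuit shows that the entries of this chain
  are units.
\<close>

section \<open>Linear combinations with coefficients on the right\<close>

text \<open>Families indexed by an arbitrary set replace the lists of \<open>right_basis\<close>, so
  that columns of a block matrix can be indexed by pairs of a matroid element and a position.
  Coefficients outside \<open>J\<close> are ignored.\<close>

definition rlin :: "nat \<Rightarrow> ('j \<Rightarrow> 'f::division_ring vec) \<Rightarrow> ('j \<Rightarrow> 'f) \<Rightarrow> 'j set \<Rightarrow> 'f vec" where
  "rlin m a x J = vec m (\<lambda>i. \<Sum>j\<in>J. a j $ i * x j)"

definition rspan :: "nat \<Rightarrow> ('j \<Rightarrow> 'f::division_ring vec) \<Rightarrow> 'j set \<Rightarrow> 'f vec set" where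
  "rspan m a J = range (\<lambda>x. rlin m a x J)"

definition rindep :: "nat \<Rightarrow> ('j \<Rightarrow> 'f::division_ring vec) \<Rightarrow> 'j set \<Rightarrow> bool" where
  "rindep m a J \<longleftrightarrow> (\<forall>x. rlin m a x J = 0\<^sub>v m \<longrightarrow> (\<forall>j\<in>J. x j = 0))"

text \<open>Gaussian elimination, by induction on the equations. The coefficients stand to the left
  of the unknowns, so subtracting a left multiple of equation \<open>p\<close> from the others is
  legitimate over a skew field and removes the unknown \<open>q\<close>.\<close>

lemma homogeneous_system:
  fixes A :: "'i \<Rightarrow> 'j \<Rightarrow> 'f::division_ring"
  assumes "finite I" "finite J" "card I < card J"
  shows "\<exists>x. (\<exists>j\<in>J. x j \<noteq> 0) \<and> (\<forall>i\<in>I. (\<Sum>j\<in>J. A i j * x j) = 0)"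
  using assms
proof (induction I arbitrary: A J rule: finite_induct)
  case empty
  then have "J \<noteq> {}" by auto
  then show ?case by (intro exI[of _ "\<lambda>_. 1"]) auto
next
  case (insert p I)
  show ?case
  proof (cases "\<forall>j\<in>J. A p j = 0")
    case True
    have "card I < card J" using insert by simp
    from insert.IH[OF insert.prems(1) this, of A] show ?thesis using True by auto
  next
    case False
    then obtain q where q: "q \<in> J" "A p q \<noteq> 0" by blast
    define K where "K = J - {q}"
    have K: "finite K" "q \<notin> K" "J = insert q K" "card I < card K"
      using insert q by (auto simp: K_def)
    define A' where "A' i j = A i j - A i q * inverse (A p q) * A p j" for i j
    from insert.IH[OF K(1,4), of A'] obtain x where x: "\<exists>j\<in>K. x j \<noteq> 0"
      and eq: "\<And>i. i \<in> I \<Longrightarrow> (\<Sum>j\<in>K. A' i j * x j) = 0" by blast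
    define s where "s = (\<Sum>j\<in>K. A p j * x j)"
    \<comment> \<open>The value at \<open>q\<close> is the one that equation \<open>p\<close> forces
      once the other unknowns are given by \<open>x\<close>.\<close>
    define y where "y = x(q := - (inverse (A p q) * s))"
    have sum_y: "(\<Sum>j\<in>J. A i j * y j) = (\<Sum>j\<in>K. A i j * x j) - A i q * inverse (A p q) * s" for i
    proof -
      have "(\<Sum>j\<in>K. A i j * y j) = (\<Sum>j\<in>K. A i j * x j)"
        using K by (intro sum.cong) (auto simp: y_def)
      then show ?thesis using K by (simp add: y_def mult.assoc)
    qed
    have "(\<Sum>j\<in>J. A i j * y j) = 0" if "i \<in> insert p I" for i
    proof (cases "i = p")
      case True
      then show ?thesis using q by (simp add: sum_y s_def)
    next
      case False
      then have "(\<Sum>j\<in>K. A' i j * x j) = 0" using that eq by auto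
      then show ?thesis
        by (simp add: sum_y s_def A'_def left_diff_distrib sum_subtractf sum_distrib_left mult.assoc)
    qed
    moreover have "\<exists>j\<in>J. y j \<noteq> 0" using x K by (auto simp: y_def)
    ultimately show ?thesis by blast
  qed
qed

lemma rlin_carrier [simp]: "rlin m a x J \<in> carrier_vec m"
  by (simp add: rlin_def)

lemma rlin_index [simp]: "i < m \<Longrightarrow> rlin m a x J $ i = (\<Sum>j\<in>J. a j $ i * x j)"
  by (simp add: rlin_def)

lemma rlin_cong: "(\<And>j. j \<in> J \<Longrightarrow> x j = y j) \<Longrightarrow> rlin m a x J = rlin m a y J"
  by (simp add: rlin_def)

lemma rspanI: "v = rlin m a x J \<Longrightarrow> v \<in> rspan m a J"
  by (auto simp: rspan_def)

lemma rspanE: "v \<in> rspan m a J \<Longrightarrow> (\<And>x. v = rlin m a x J \<Longrightarrow> P) \<Longrightarrow> P"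
  by (auto simp: rspan_def)

lemma rspan_base:
  assumes "finite J" "j \<in> J" "a j \<in> carrier_vec m"
  shows "a j \<in> rspan m a J"
proof (rule rspanI)
  show "a j = rlin m a (\<lambda>l. if l = j then 1 else 0) J"
    using assms by (intro eq_vecI) (auto simp: rlin_def if_distrib[where f = "\<lambda>x. _ * x"] cong: if_cong)
qed

lemma rspan_trans:
  assumes "\<And>j. j \<in> J \<Longrightarrow> a j \<in> rspan m b K"
  shows "rspan m a J \<subseteq> rspan m b K"
proof
  fix v assume "v \<in> rspan m a J"
  then obtain x where v: "v = rlin m a x J" by (rule rspanE)
  have "\<forall>j\<in>J. \<exists>c. a j = rlin m b c K" using assms by (auto simp: rspan_def)
  then obtain c where c: "\<And>j. j \<in> J \<Longrightarrow> a j = rlin m b (c j) K" by metis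
  show "v \<in> rspan m b K"
  proof (rule rspanI)
    show "v = rlin m b (\<lambda>k. \<Sum>j\<in>J. c j k * x j) K"
    proof (rule eq_vecI)
      fix i assume "i < dim_vec (rlin m b (\<lambda>k. \<Sum>j\<in>J. c j k * x j) K)"
      then have i: "i < m" by (simp add: rlin_def)
      have "v $ i = (\<Sum>j\<in>J. (\<Sum>k\<in>K. b k $ i * c j k) * x j)" using i by (simp add: v c)
      also have "\<dots> = (\<Sum>k\<in>K. \<Sum>j\<in>J. b k $ i * (c j k * x j))"
        by (subst sum.swap) (simp add: sum_distrib_right mult.assoc)
      finally show "v $ i = rlin m b (\<lambda>k. \<Sum>j\<in>J. c j k * x j) K $ i"
        using i by (simp add: sum_distrib_left)
    qed (simp add: v rlin_def)
  qed
qed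

text \<open>The coordinates \<open>d\<close> and those of the \<open>a j\<close> form a homogeneous system with one more unknown
  than equations.\<close>

lemma rspan_dependence:
  assumes fin: "finite J" "finite K" and card: "card J = card K"
    and a: "\<And>j. j \<in> J \<Longrightarrow> a j \<in> rspan m b K"
  obtains c x s where "s \<noteq> 0 \<or> (\<exists>j\<in>J. x j \<noteq> 0)"
    "\<And>k. k \<in> K \<Longrightarrow> (\<Sum>j\<in>J. c j k * x j) = - (d k * s)"
    "\<And>i. i < m \<Longrightarrow> (\<Sum>j\<in>J. a j $ i * x j) = - (rlin m b d K $ i * s)"
proof -
  have "\<forall>j\<in>J. \<exists>c. a j = rlin m b c K" using a by (auto simp: rspan_def)
  then obtain c where c: "\<And>j. j \<in> J \<Longrightarrow> a j = rlin m b (c j) K" by metis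
  define A where "A k = case_option (d k) (\<lambda>j. c j k)" for k
  define S where "S = insert None (Some ` J)"
  have S: "finite S" "card K < card S" using fin card by (auto simp: S_def card_image)
  obtain y where y: "\<exists>j\<in>S. y j \<noteq> 0" and eq: "\<And>k. k \<in> K \<Longrightarrow> (\<Sum>j\<in>S. A k j * y j) = 0"
    using homogeneous_system[OF fin(2) S, of A] by blast
  have eq: "(\<Sum>j\<in>J. c j k * y (Some j)) = - (d k * y None)" if "k \<in> K" for k
    using eq[OF that] fin by (simp add: S_def A_def sum.reindex eq_neg_iff_add_eq_0 add.commute)
  have "(\<Sum>j\<in>J. a j $ i * y (Some j)) = - (rlin m b d K $ i * y None)" if i: "i < m" for i
  proof -
    have "(\<Sum>j\<in>J. a j $ i * y (Some j)) = (\<Sum>j\<in>J. (\<Sum>k\<in>K. b k $ i * c j k) * y (Some j))"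
      using i c by simp
    also have "\<dots> = (\<Sum>k\<in>K. b k $ i * (\<Sum>j\<in>J. c j k * y (Some j)))"
      unfolding sum_distrib_left sum_distrib_right by (subst sum.swap) (simp add: mult.assoc)
    also have "\<dots> = (\<Sum>k\<in>K. - (b k $ i * d k * y None))"
      by (rule sum.cong) (simp_all add: eq mult.assoc)
    also have "\<dots> = - (rlin m b d K $ i * y None)"
      using i by (simp add: sum_negf sum_distrib_right)
    finally show ?thesis .
  qed
  moreover have "y None \<noteq> 0 \<or> (\<exists>j\<in>J. y (Some j) \<noteq> 0)" using y by (auto simp: S_def)
  ultimately show ?thesis using eq by (intro that[of "y None" "\<lambda>j. y (Some j)" c])
qed

text \<open>In the relation of \<open>rspan_dependence\<close> the coefficient \<open>s\<close> of
  \<open>v\<close> is nonzero, since otherwise the \<open>a j\<close> would be dependent. Dividing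
  by \<open>s\<close> on the right expresses \<open>v\<close> through the
  \<open>a j\<close>.\<close>

lemma rspan_of_rindep:
  assumes "finite J" "finite K" "card J = card K" and indep: "rindep m a J"
    and "\<And>j. j \<in> J \<Longrightarrow> a j \<in> rspan m b K" and v: "v \<in> rspan m b K"
  shows "v \<in> rspan m a J"
proof -
  obtain d where d: "v = rlin m b d K" using v by (rule rspanE)
  obtain s x c where nz: "s \<noteq> 0 \<or> (\<exists>j\<in>J. x j \<noteq> 0)"
    and "\<And>k. k \<in> K \<Longrightarrow> (\<Sum>j\<in>J. c j k * x j) = - (d k * s)"
    and rel: "\<And>i. i < m \<Longrightarrow> (\<Sum>j\<in>J. a j $ i * x j) = - (rlin m b d K $ i * s)"
    by (rule rspan_dependence[OF assms(1-3), where a = a and m = m and b = b and d = d])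
      (rule assms(5), assumption, rule that)
  note rel = rel[folded d]
  have "s \<noteq> 0"
  proof
    assume z: "s = 0"
    have "rlin m a x J = 0\<^sub>v m" using rel by (intro eq_vecI) (auto simp: z rlin_def)
    then show False using indep nz z by (auto simp: rindep_def)
  qed
  have "v = rlin m a (\<lambda>j. - (x j * inverse s)) J"
  proof (rule eq_vecI)
    fix i assume "i < dim_vec (rlin m a (\<lambda>j. - (x j * inverse s)) J)"
    then have i: "i < m" by (simp add: rlin_def)
    have "v $ i = - (- (v $ i * s) * inverse s)" using \<open>s \<noteq> 0\<close> by (simp add: mult.assoc)
    also have "\<dots> = - ((\<Sum>j\<in>J. a j $ i * x j) * inverse s)" by (simp only: rel[OF i])
    finally show "v $ i = rlin m a (\<lambda>j. - (x j * inverse s)) J $ i"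
      using i by (simp add: sum_negf sum_distrib_right mult.assoc)
  qed (simp add: d rlin_def)
  then show ?thesis by (rule rspanI)
qed

text \<open>If \<open>d\<close> gives a vanishing combination, the relation of
  \<open>rspan_dependence\<close> involves the \<open>a j\<close> alone, so all \<open>x j\<close>
  are 0 and \<open>s\<close> is not. The coordinate equations then read
  \<open>d k * s = 0\<close>.\<close>

lemma rindep_of_spanning:
  assumes "finite J" "finite K" "card J = card K" and indep: "rindep m a J"
    and "\<And>j. j \<in> J \<Longrightarrow> a j \<in> rspan m b K"
  shows "rindep m b K"
  unfolding rindep_def
proof (intro allI impI)
  fix d assume d: "rlin m b d K = 0\<^sub>v m"
  obtain s x c where nz: "s \<noteq> 0 \<or> (\<exists>j\<in>J. x j \<noteq> 0)"
    and eq: "\<And>k. k \<in> K \<Longrightarrow> (\<Sum>j\<in>J. c j k * x j) = - (d k * s)"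
    and rel: "\<And>i. i < m \<Longrightarrow> (\<Sum>j\<in>J. a j $ i * x j) = - (rlin m b d K $ i * s)"
    by (rule rspan_dependence[OF assms(1-3), where a = a and m = m and b = b and d = d])
      (rule assms(5), assumption, rule that)
  have "(\<Sum>j\<in>J. a j $ i * x j) = 0" if "i < m" for i using rel[OF that] that by (simp only: d) simp
  then have "rlin m a x J = 0\<^sub>v m" by (intro eq_vecI) (auto simp: rlin_def)
  then have z: "\<forall>j\<in>J. x j = 0" using indep by (simp add: rindep_def)
  then have "s \<noteq> 0" using nz by auto
  then show "\<forall>k\<in>K. d k = 0" using eq z by auto
qed

section \<open>Bases and dimensions of right subspaces\<close>

lemma mat_of_cols_mult_vec:
  fixes vs :: "'f::division_ring vec list"
  assumes "c \<in> carrier_vec (length vs)"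
  shows "mat_of_cols m vs *\<^sub>v c = rlin m ((!) vs) (($) c) {..<length vs}"
  using assms
  by (intro eq_vecI) (auto simp: rlin_def scalar_prod_def lessThan_atLeast0 mat_of_cols_index)

text \<open>Coefficient vectors and coefficient functions differ only in values outside the index
  set, which do not affect \<open>rlin\<close>.\<close>

lemma right_basis_iff:
  fixes vs :: "'f::division_ring vec list"
  shows "right_basis m W vs \<longleftrightarrow> set vs \<subseteq> carrier_vec m \<and>
    rindep m ((!) vs) {..<length vs} \<and> W = rspan m ((!) vs) {..<length vs}"
proof -
  have vec: "rlin m ((!) vs) x {..<length vs} = mat_of_cols m vs *\<^sub>v vec (length vs) x" for x
    by (subst mat_of_cols_mult_vec) (auto intro: rlin_cong)
  have "rspan m ((!) vs) {..<length vs} = {mat_of_cols m vs *\<^sub>v c |c. c \<in> carrier_vec (length vs)}"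
  proof (intro equalityI subsetI)
    fix v assume "v \<in> rspan m ((!) vs) {..<length vs}"
    then obtain x where "v = rlin m ((!) vs) x {..<length vs}" by (rule rspanE)
    then have "v = mat_of_cols m vs *\<^sub>v vec (length vs) x" by (simp only: vec)
    then show "v \<in> {mat_of_cols m vs *\<^sub>v c |c. c \<in> carrier_vec (length vs)}"
      by (intro CollectI exI[of _ "vec (length vs) x"]) simp
  next
    fix v assume "v \<in> {mat_of_cols m vs *\<^sub>v c |c. c \<in> carrier_vec (length vs)}"
    then obtain c where "c \<in> carrier_vec (length vs)" "v = mat_of_cols m vs *\<^sub>v c" by blast
    then show "v \<in> rspan m ((!) vs) {..<length vs}" by (intro rspanI) (simp only: mat_of_cols_mult_vec)
  qed
  moreover have "rindep m ((!) vs) {..<length vs} \<longleftrightarrow>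
    (\<forall>c\<in>carrier_vec (length vs). mat_of_cols m vs *\<^sub>v c = 0\<^sub>v m \<longrightarrow> c = 0\<^sub>v (length vs))"
    unfolding rindep_def
  proof (intro iffI ballI allI impI)
    fix c assume *: "\<forall>x. rlin m ((!) vs) x {..<length vs} = 0\<^sub>v m \<longrightarrow> (\<forall>j\<in>{..<length vs}. x j = 0)"
      and c: "c \<in> carrier_vec (length vs)" and "mat_of_cols m vs *\<^sub>v c = 0\<^sub>v m"
    then have "rlin m ((!) vs) (($) c) {..<length vs} = 0\<^sub>v m" by (simp only: mat_of_cols_mult_vec)
    then have "\<forall>j\<in>{..<length vs}. c $ j = 0" using * by blast
    then show "c = 0\<^sub>v (length vs)" using c by (intro eq_vecI) auto
  next
    fix x j
    assume *: "\<forall>c\<in>carrier_vec (length vs). mat_of_cols m vs *\<^sub>v c = 0\<^sub>v m \<longrightarrow> c = 0\<^sub>v (length vs)"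
      and "rlin m ((!) vs) x {..<length vs} = 0\<^sub>v m" and j: "j \<in> {..<length vs}"
    then have "vec (length vs) x = 0\<^sub>v (length vs)" by (simp add: vec)
    then have "vec (length vs) x $ j = 0\<^sub>v (length vs) $ j" by simp
    then show "x j = 0" using j by simp
  qed
  ultimately show ?thesis unfolding right_basis_def by simp
qed

lemma has_right_dimE:
  assumes "has_right_dim m W d"
  obtains a where "\<And>j. j < d \<Longrightarrow> a j \<in> carrier_vec m" "rindep m a {..<d}" "W = rspan m a {..<d}"
  using assms by (force simp: has_right_dim_def right_basis_iff)

text \<open>Dimension is defined through lists, so the index set is enumerated by a bijection
  \<open>h\<close>; coefficients are carried along \<open>h\<close> and back along
  \<open>h'\<close>.\<close>

lemma has_right_dim_rspan:
  assumes "finite J" "\<And>j. j \<in> J \<Longrightarrow> a j \<in> carrier_vec m" "rindep m a J"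
  shows "has_right_dim m (rspan m a J) (card J)"
proof -
  let ?d = "card J"
  obtain h where h: "bij_betw h {..<?d} J"
    using ex_bij_betw_nat_finite[OF assms(1)] by (auto simp: lessThan_atLeast0)
  define vs where "vs = map (a \<circ> h) [0..<?d]"
  have len: "length vs = ?d" by (simp add: vs_def)
  have reindex: "rlin m ((!) vs) (x \<circ> h) {..<?d} = rlin m a x J" for x
  proof -
    have "(\<Sum>j\<in>J. a j $ i * x j) = (\<Sum>k<?d. vs ! k $ i * x (h k))" for i
      by (subst sum.reindex_bij_betw[OF h, symmetric]) (simp add: vs_def)
    then show ?thesis by (simp add: rlin_def)
  qed
  obtain h' where h': "\<And>k. k < ?d \<Longrightarrow> h' (h k) = k"
    using h by (metis bij_betw_inv_into_left lessThan_iff)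
  have reindex': "rlin m ((!) vs) x {..<?d} = rlin m a (x \<circ> h') J" for x
    by (subst reindex[symmetric]) (auto intro!: rlin_cong simp: h')
  have "rspan m ((!) vs) {..<?d} = rspan m a J"
    by (auto elim!: rspanE intro: rspanI[OF reindex'] rspanI[OF reindex[symmetric]])
  moreover have "rindep m ((!) vs) {..<?d}"
    unfolding rindep_def
  proof (intro allI impI)
    fix x assume "rlin m ((!) vs) x {..<?d} = 0\<^sub>v m"
    then have "\<forall>j\<in>J. (x \<circ> h') j = 0" using assms(3) unfolding reindex' rindep_def by blast
    then show "\<forall>j\<in>{..<?d}. x j = 0" using h h' by (metis bij_betwE comp_apply lessThan_iff)
  qed
  moreover have "set vs \<subseteq> carrier_vec m"
    using assms(2) bij_betwE[OF h] by (auto simp: vs_def)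
  ultimately show ?thesis unfolding has_right_dim_def right_basis_iff by (intro exI[of _ vs]) (simp add: len)
qed

lemma right_subspace_rspan: "right_subspace m (rspan m a J)"
  unfolding right_subspace_def
proof (intro conjI ballI allI)
  show "rspan m a J \<subseteq> carrier_vec m" by (auto elim!: rspanE)
  show "0\<^sub>v m \<in> rspan m a J" by (rule rspanI[of _ _ _ "\<lambda>_. 0"]) (simp add: rlin_def zero_vec_def)
next
  fix v w assume "v \<in> rspan m a J" "w \<in> rspan m a J"
  then obtain x y where "v = rlin m a x J" "w = rlin m a y J" by (metis rspanE)
  then have "v + w = rlin m a (\<lambda>j. x j + y j) J"
    by (auto simp: rlin_def distrib_left sum.distrib)
  then show "v + w \<in> rspan m a J" by (rule rspanI)
next
  fix v and c :: 'a assume "v \<in> rspan m a J"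
  then obtain x where "v = rlin m a x J" by (rule rspanE)
  then have "right_smult_vec v c = rlin m a (\<lambda>j. x j * c) J"
    by (auto simp: rlin_def right_smult_vec_def sum_distrib_right mult.assoc)
  then show "right_smult_vec v c \<in> rspan m a J" by (rule rspanI)
qed

text \<open>Choosing coefficients for each element of \<open>X\<close> separately is the same as
  choosing them on pairs. This turns the rank condition on sums of subspaces into one on the columns
  of a block matrix.\<close>

lemma subspace_sum_rspan:
  fixes a :: "'e \<times> nat \<Rightarrow> 'f::division_ring vec"
  assumes "finite X" "\<And>e. e \<in> X \<Longrightarrow> V e = rspan m (\<lambda>k. a (e, k)) {..<n}"
  shows "subspace_sum m V X = rspan m a (X \<times> {..<n})"
proof -
  have sum: "finsum_vec TYPE('f) m (\<lambda>e. rlin m (\<lambda>k. a (e, k)) (x e) {..<n}) X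
      = rlin m a (\<lambda>(e, k). x e k) (X \<times> {..<n})" (is "?l = ?r") for x
  proof (rule eq_vecI)
    fix i assume "i < dim_vec ?r"
    then have i: "i < m" by (simp add: rlin_def)
    then show "?l $ i = ?r $ i"
      by (subst index_finsum_vec[OF assms(1)])
        (auto simp: sum.cartesian_product intro!: sum.cong)
  next
    have "?l \<in> carrier_vec m" by (rule finsum_vec_closed) auto
    then show "dim_vec ?l = dim_vec ?r" by (simp add: rlin_def)
  qed
  show ?thesis
  proof (intro equalityI subsetI)
    fix v assume "v \<in> subspace_sum m V X"
    then obtain w where w: "w \<in> Pi X V" and v: "v = finsum_vec TYPE('f) m w X"
      by (auto simp: subspace_sum_def)
    have "\<forall>e\<in>X. \<exists>x. w e = rlin m (\<lambda>k. a (e, k)) x {..<n}"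
      using w assms(2) by (force simp: rspan_def)
    then obtain x where x: "\<And>e. e \<in> X \<Longrightarrow> w e = rlin m (\<lambda>k. a (e, k)) (x e) {..<n}" by metis
    \<comment> \<open>\<open>finsum_vec\<close> is a product in the commutative monoid of vectors,
      so the congruence rule for such products allows the summands to be replaced on
      \<open>X\<close>.\<close>
    have "v = finsum_vec TYPE('f) m (\<lambda>e. rlin m (\<lambda>k. a (e, k)) (x e) {..<n}) X"
      unfolding v by (rule comm_monoid.finprod_cong'[OF comm_monoid_vec, folded finsum_vec_def, unfolded monoid_vec_simps]) (auto simp: x)
    then show "v \<in> rspan m a (X \<times> {..<n})" unfolding sum by (rule rspanI)
  next
    fix v assume "v \<in> rspan m a (X \<times> {..<n})"
    then obtain x where "v = rlin m a x (X \<times> {..<n})" by (rule rspanE)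
    then have "v = finsum_vec TYPE('f) m (\<lambda>e. rlin m (\<lambda>k. a (e, k)) (\<lambda>k. x (e, k)) {..<n}) X"
      by (simp add: sum split_def)
    then show "v \<in> subspace_sum m V X"
      unfolding subspace_sum_def using assms(2)
      by (auto intro!: exI[of _ "\<lambda>e. rlin m (\<lambda>k. a (e, k)) (\<lambda>k. x (e, k)) {..<n}"] rspanI)
  qed
qed

lemma carrier_vec_rspan_unit_vec:
  fixes v :: "'f::division_ring vec"
  assumes "v \<in> carrier_vec m"
  shows "v \<in> rspan m (unit_vec m) {..<m}"
proof (rule rspanI)
  show "v = rlin m (unit_vec m) (($) v) {..<m}"
  proof (rule eq_vecI)
    fix i assume "i < dim_vec (rlin m (unit_vec m) (($) v) {..<m})"
    then have i: "i < m" by (simp add: rlin_def)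
    have "(\<Sum>j<m. (unit_vec m j $ i :: 'f) * v $ j) = (\<Sum>j<m. if j = i then v $ j else 0)"
      using i by (intro sum.cong) auto
    then show "v $ i = rlin m (unit_vec m) (($) v) {..<m} $ i" using i by simp
  qed (use assms in \<open>simp add: rlin_def\<close>)
qed

text \<open>The coordinates of the unit vectors with respect to the \<open>a j\<close> form a right inverse of the
  matrix with columns \<open>a j\<close>; cancelling the independent columns shows that it is a left inverse
  as well.\<close>

lemma rindep_left_inverse:
  fixes a :: "'j \<Rightarrow> 'f::division_ring vec"
  assumes J: "finite J" "card J = m" and a: "\<And>j. j \<in> J \<Longrightarrow> a j \<in> carrier_vec m"
    and indep: "rindep m a J"
  obtains y where "\<And>j l. j \<in> J \<Longrightarrow> l \<in> J \<Longrightarrow> (\<Sum>i<m. y j i * a l $ i) = (if j = l then 1 else 0)"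
proof -
  have "unit_vec m i \<in> rspan m a J" for i
  proof (rule rspan_of_rindep[OF J(1) _ _ indep])
    show "a j \<in> rspan m (unit_vec m) {..<m}" if "j \<in> J" for j
      using a[OF that] by (rule carrier_vec_rspan_unit_vec)
    show "unit_vec m i \<in> rspan m (unit_vec m) {..<m}"
      by (rule carrier_vec_rspan_unit_vec) simp
  qed (use J in auto)
  then have "\<forall>i. \<exists>x. unit_vec m i = rlin m a x J" by (auto simp: rspan_def)
  then obtain x where x: "\<And>i. unit_vec m i = rlin m a (x i) J" by metis
  have "(\<Sum>i<m. x i j * a l $ i) = (if j = l then 1 else 0)" if j: "j \<in> J" and l: "l \<in> J" for j l
  proof -
    \<comment> \<open>With \<open>A\<close> the matrix of columns \<open>a j\<close> and
      \<open>Y\<close> the right inverse with entries \<open>x i j\<close>, \<open>z\<close> is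
      column \<open>l\<close> of \<open>Y A\<close>. From \<open>A (Y A) = (A Y) A = A\<close>, the
      vector \<open>z\<close> and the unit column at \<open>l\<close> have the same image under
      \<open>A\<close>.\<close>
    define z where "z j = (\<Sum>i<m. x i j * a l $ i)" for j
    have "(\<Sum>j\<in>J. a j $ p * (z j - (if j = l then 1 else 0))) = 0" if p: "p < m" for p
    proof -
      have "(\<Sum>j\<in>J. a j $ p * z j) = (\<Sum>i<m. (\<Sum>j\<in>J. a j $ p * x i j) * a l $ i)"
        unfolding z_def sum_distrib_left sum_distrib_right
        by (subst sum.swap) (simp add: mult.assoc)
      also have "\<dots> = (\<Sum>i<m. unit_vec m i $ p * a l $ i)"
        using p by (simp add: x)
      also have "\<dots> = (\<Sum>i<m. if i = p then a l $ i else 0)"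
        using p by (intro sum.cong) auto
      also have "\<dots> = a l $ p" using p by simp
      also have "\<dots> = (\<Sum>j\<in>J. if j = l then a j $ p else 0)" using l J by simp
      also have "\<dots> = (\<Sum>j\<in>J. a j $ p * (if j = l then 1 else 0))" by (intro sum.cong) auto
      finally show ?thesis by (simp only: right_diff_distrib sum_subtractf diff_self)
    qed
    then have "rlin m a (\<lambda>j. z j - (if j = l then 1 else 0)) J = 0\<^sub>v m"
      by (intro eq_vecI) (auto simp: rlin_def)
    then have "z j - (if j = l then 1 else 0) = 0" using indep j unfolding rindep_def by blast
    then show ?thesis by (simp add: z_def)
  qed
  then show ?thesis by (rule that[of "\<lambda>j i. x i j"])
qed

section \<open>Bases and cocircuits\<close>

context matroid
begin

lemma finite_indep: "indep X \<Longrightarrow> finite X"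
  using finite_ground indep_ground finite_subset by blast

text \<open>A largest independent set between \<open>X\<close> and the union cannot be smaller than
  \<open>Y\<close>, since augmentation from \<open>Y\<close> would enlarge it.\<close>

lemma indep_extend:
  assumes "indep X" "indep Y"
  obtains Z where "X \<subseteq> Z" "Z \<subseteq> X \<union> Y" "indep Z" "card Y \<le> card Z"
proof -
  let ?P = "\<lambda>Z. X \<subseteq> Z \<and> Z \<subseteq> X \<union> Y \<and> indep Z"
  have "?P X" using assms by auto
  moreover have "\<forall>Z. ?P Z \<longrightarrow> card Z < Suc (card (X \<union> Y))"
    using assms finite_indep by (auto simp: less_Suc_eq_le intro!: card_mono)
  ultimately have "\<exists>Z. ?P Z \<and> (\<forall>Z'. ?P Z' \<longrightarrow> card Z' \<le> card Z)"
    by (rule ex_has_greatest_nat[where P = ?P and f = card])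
  then obtain Z where Z: "?P Z" and max: "\<forall>Z'. ?P Z' \<longrightarrow> card Z' \<le> card Z"
    by blast
  note max = max[rule_format]
  have "card Y \<le> card Z"
  proof (rule ccontr)
    assume "\<not> card Y \<le> card Z"
    then obtain y where y: "y \<in> Y - Z" "indep (insert y Z)"
      using indep_augment[of Z Y] Z assms by auto
    then have "card (insert y Z) \<le> card Z" using Z by (intro max) auto
    then show False using y Z finite_indep by simp
  qed
  then show ?thesis using Z that by blast
qed

text \<open>\<open>matroid_basis\<close> is applied to any set \<open>X\<close>, not only to the
  ground set, so that bases of subsets are available for computing ranks.\<close>

lemma basis_card_max:
  assumes "matroid_basis X indep B" "indep Y" "Y \<subseteq> X"
  shows "card Y \<le> card B"
proof (rule ccontr)
  assume "\<not> card Y \<le> card B"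
  then obtain y where "y \<in> Y - B" "indep (insert y B)"
    using indep_augment[of B Y] assms by (auto simp: matroid_basis_def)
  then show False using assms unfolding matroid_basis_def by blast
qed

lemma basis_of_card:
  assumes "matroid_basis X indep B" "indep Y" "Y \<subseteq> X" "card B \<le> card Y"
  shows "matroid_basis X indep Y"
  unfolding matroid_basis_def
proof (intro conjI allI impI notI)
  fix Z assume Z: "Y \<subset> Z \<and> Z \<subseteq> X" "indep Z"
  then have "card Y < card Z" using finite_indep by (intro psubset_card_mono) auto
  then show False using basis_card_max[of X B Z] assms Z by auto
qed (use assms in auto)

lemma basis_exists:
  obtains B where "matroid_basis X indep B"
proof -
  let ?P = "\<lambda>Z. Z \<subseteq> X \<and> indep Z"
  have "?P {}" using indep_empty by auto
  moreover have "\<forall>Z. ?P Z \<longrightarrow> card Z < Suc (card E)"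
    using finite_ground indep_ground by (auto simp: less_Suc_eq_le intro!: card_mono)
  ultimately have "\<exists>Z. ?P Z \<and> (\<forall>Z'. ?P Z' \<longrightarrow> card Z' \<le> card Z)"
    by (rule ex_has_greatest_nat[where P = ?P and f = card])
  then obtain Z where Z: "?P Z" and max: "\<forall>Z'. ?P Z' \<longrightarrow> card Z' \<le> card Z"
    by blast
  note max = max[rule_format]
  have "matroid_basis X indep Z"
    unfolding matroid_basis_def
  proof (intro conjI allI impI notI)
    fix W assume W: "Z \<subset> W \<and> W \<subseteq> X" "indep W"
    then have "card Z < card W" using finite_indep by (intro psubset_card_mono) auto
    then show False using max[of W] W by auto
  qed (use Z in auto)
  then show ?thesis by (rule that)
qed

lemma extend_to_basis:
  assumes "indep X" "matroid_basis E indep B"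
  obtains B' where "matroid_basis E indep B'" "X \<subseteq> B'" "B' \<subseteq> X \<union> B"
proof -
  obtain Z where "X \<subseteq> Z" "Z \<subseteq> X \<union> B" "indep Z" "card B \<le> card Z"
    using indep_extend[of X B] assms by (auto simp: matroid_basis_def)
  then show ?thesis using basis_of_card[OF assms(2), of Z] indep_ground that by blast
qed

lemma rank_eq_card:
  assumes "matroid_basis X indep B"
  shows "matroid_rank indep X = card B"
  unfolding matroid_rank_def
proof (rule Max_eqI)
  have "{Y. Y \<subseteq> X \<and> indep Y} \<subseteq> Pow E" using indep_ground by auto
  then show "finite (card ` {Y. Y \<subseteq> X \<and> indep Y})"
    using finite_ground by (simp add: finite_subset)
qed (use assms basis_card_max in \<open>auto simp: matroid_basis_def\<close>)

lemma cocircuit_ground: "D \<in> cocircuits E indep \<Longrightarrow> D \<subseteq> E"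
  by (simp add: cocircuits_def circuits_def)

lemma cocircuit_meets_basis:
  assumes "D \<in> cocircuits E indep" "matroid_basis E indep B"
  shows "D \<inter> B \<noteq> {}"
proof
  assume "D \<inter> B = {}"
  then have "dual_indep E indep D"
    using assms cocircuit_ground unfolding dual_indep_def by blast
  then show False using assms by (simp add: cocircuits_def circuits_def)
qed

text \<open>By minimality of \<open>D\<close> some basis avoids \<open>D - {f}\<close>. It must
  still meet \<open>D\<close>, which leaves only \<open>f\<close>.\<close>

lemma cocircuit_basis:
  assumes "D \<in> cocircuits E indep" "f \<in> D"
  obtains B where "matroid_basis E indep B" "D \<inter> B = {f}"
proof -
  have "D - {f} \<subset> D" using assms(2) by blast
  then have "dual_indep E indep (D - {f})"
    using assms(1) by (simp add: cocircuits_def circuits_def)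
  then obtain B where B: "matroid_basis E indep B" "D - {f} \<subseteq> E - B"
    by (auto simp: dual_indep_def)
  then have "D \<inter> B = {f}" using cocircuit_meets_basis[OF assms(1) B(1)] by blast
  then show ?thesis using B that by blast
qed

text \<open>The complement of a cocircuit is closed: extend \<open>X\<close> by elements of a basis
  that meets \<open>D\<close> only in \<open>e\<close>. The resulting basis has to meet
  \<open>D\<close>, and it can do so only in \<open>e\<close>.\<close>

lemma cocircuit_spans:
  assumes D: "D \<in> cocircuits E indep" "e \<in> D" and X: "indep X" "D \<inter> X = {}"
  shows "indep (insert e X)"
proof -
  obtain B where B: "matroid_basis E indep B" "D \<inter> B = {e}" using D by (rule cocircuit_basis)
  obtain B' where B': "matroid_basis E indep B'" "X \<subseteq> B'" "B' \<subseteq> X \<union> B"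
    using X(1) B(1) by (rule extend_to_basis)
  have "D \<inter> B' \<subseteq> {e}" using B'(3) B(2) X(2) by blast
  then have "e \<in> B'" using cocircuit_meets_basis[OF D(1) B'(1)] by blast
  then have "insert e X \<subseteq> B'" "indep B'" using B' by (auto simp: matroid_basis_def)
  then show ?thesis using indep_subset by blast
qed

text \<open>\<open>B - {f}\<close> avoids \<open>D\<close>, so \<open>e\<close> can be added to it,
  and the result has the size of a basis.\<close>

lemma cocircuit_exchange:
  assumes D: "D \<in> cocircuits E indep" "e \<in> D" and B: "matroid_basis E indep B" "D \<inter> B = {f}"
  shows "matroid_basis E indep (insert e (B - {f}))"
proof (rule basis_of_card[OF B(1)])
  have "indep (B - {f})"
    using B(1) indep_subset[of B "B - {f}"] by (auto simp: matroid_basis_def)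
  then show *: "indep (insert e (B - {f}))" using D B by (intro cocircuit_spans) auto
  show "insert e (B - {f}) \<subseteq> E" using indep_ground[OF *] .
  have "f \<in> B" "e \<notin> B - {f}" "finite B" using B D finite_indep by (auto simp: matroid_basis_def)
  then show "card B \<le> card (insert e (B - {f}))" using card_Suc_Diff1[of B f] by simp
qed

text \<open>\<open>D\<close> consists of the elements outside the closure of \<open>B - {b}\<close>.
  Augmenting \<open>B - {b}\<close> from any basis shows that this basis meets \<open>D\<close>. For
  each \<open>x\<close> in \<open>D\<close>, adding \<open>x\<close> to \<open>B - {b}\<close> gives
  a basis that meets \<open>D\<close> only in \<open>x\<close>, hence minimality.\<close>

lemma fundamental_cocircuit:
  assumes B: "matroid_basis E indep B" and b: "b \<in> B"
  obtains D where "D \<in> cocircuits E indep" "D \<inter> B = {b}"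
proof -
  let ?B = "B - {b}"
  define D where "D = {e. e \<notin> ?B \<and> indep (insert e ?B)}"
  have B': "indep B" "B \<subseteq> E" "indep ?B" "finite B"
    using B finite_indep indep_subset[of B ?B] by (auto simp: matroid_basis_def)
  have "D \<inter> B = {b}" using b B' by (auto simp: D_def insert_absorb)
  moreover have "D \<in> cocircuits E indep"
    unfolding cocircuits_def circuits_def
  proof (intro CollectI conjI allI impI notI)
    show DE: "D \<subseteq> E" using indep_ground by (auto simp: D_def)
    show False if dual: "dual_indep E indep D"
    proof -
      obtain A where A: "matroid_basis E indep A" "D \<subseteq> E - A"
        using dual by (auto simp: dual_indep_def)
      have "card ?B < card A"
        using card_Diff1_less[OF B'(4) b] basis_card_max[OF A(1) B'(1,2)] by simp
      then obtain y where "y \<in> A - ?B" "indep (insert y ?B)"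
        using indep_augment[OF B'(3), of A] A by (auto simp: matroid_basis_def)
      then show False using A by (auto simp: D_def)
    qed
    fix X assume "X \<subset> D"
    then obtain x where x: "x \<in> D" "x \<notin> X" "X \<subseteq> D" by blast
    have "matroid_basis E indep (insert x ?B)"
    proof (rule basis_of_card[OF B])
      show "card B \<le> card (insert x ?B)"
        using card_Suc_Diff1[of B b] x b B' by (simp add: D_def)
    qed (use x DE B' in \<open>auto simp: D_def\<close>)
    then show "dual_indep E indep X"
      unfolding dual_indep_def using x DE by (intro exI[of _ "insert x ?B"]) (auto simp: D_def)
  qed
  ultimately show ?thesis using that by blast
qed

text \<open>\<open>S\<close> is dependent in the dual, and a dually dependent subset of least size
  is a cocircuit.\<close>

lemma contains_cocircuit:
  assumes "S \<subseteq> E" "\<And>B. matroid_basis E indep B \<Longrightarrow> S \<inter> B \<noteq> {}"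
  obtains D where "D \<in> cocircuits E indep" "D \<subseteq> S"
proof -
  let ?P = "\<lambda>X. X \<subseteq> S \<and> \<not> dual_indep E indep X"
  have "?P S" using assms by (auto simp: dual_indep_def)
  then have "\<exists>D. ?P D \<and> (\<forall>X. ?P X \<longrightarrow> card D \<le> card X)"
    by (rule ex_has_least_nat[where P = ?P and m = card])
  then obtain D where D: "?P D" and min: "\<forall>X. ?P X \<longrightarrow> card D \<le> card X"
    by blast
  note min = min[rule_format]
  have "D \<in> cocircuits E indep"
    unfolding cocircuits_def circuits_def
  proof (intro CollectI conjI allI impI)
    fix X assume X: "X \<subset> D"
    have "finite D" using D assms(1) finite_ground by (meson finite_subset)
    then have "card X < card D" using X by (rule psubset_card_mono)
    then show "dual_indep E indep X" using min[of X] D X by fastforce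
  qed (use D assms in auto)
  then show ?thesis using D that by blast
qed

end

section \<open>Row spaces\<close>

text \<open>A left subspace of the functions on \<open>E \<times> {..<n}\<close>, encoded by total
  functions; the last clause makes membership independent of the values elsewhere.\<close>

definition row_space :: "nat \<Rightarrow> 'e set \<Rightarrow> ('e \<times> nat \<Rightarrow> 'f::division_ring) set \<Rightarrow> bool" where
  "row_space n E U \<longleftrightarrow> (\<lambda>_. 0) \<in> U \<and>
     (\<forall>u\<in>U. \<forall>v\<in>U. (\<lambda>j. u j + v j) \<in> U) \<and>
     (\<forall>u\<in>U. \<forall>a. (\<lambda>j. a * u j) \<in> U) \<and>
     (\<forall>u\<in>U. \<forall>v. (\<forall>j\<in>E \<times> {..<n}. v j = u j) \<longrightarrow> v \<in> U)"

text \<open>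
  If \<open>U\<close> is the row space of a matrix with column blocks \<open>A e\<close>, the first condition says that the
  columns of the \<open>A e\<close> with \<^term>\<open>e \<in> B\<close> are independent, and the second that they span the
  columns of \<open>A e\<close> for every \<open>e\<close> in the closure of \<open>B\<close>.
\<close>

definition row_representation ::
    "nat \<Rightarrow> 'e set \<Rightarrow> ('e set \<Rightarrow> bool) \<Rightarrow> ('e \<times> nat \<Rightarrow> 'f::division_ring) set \<Rightarrow> bool" where
  "row_representation n E indep U \<longleftrightarrow> row_space n E U \<and>
     (\<forall>B g. indep B \<longrightarrow> (\<exists>u\<in>U. \<forall>j\<in>B \<times> {..<n}. u j = g j)) \<and>
     (\<forall>B e u. indep B \<and> e \<in> E \<and> \<not> indep (insert e B) \<and> u \<in> U \<and> (\<forall>j\<in>B \<times> {..<n}. u j = 0)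
       \<longrightarrow> (\<forall>k<n. u (e, k) = 0))"

lemma row_space_zero: "row_space n E U \<Longrightarrow> (\<lambda>_. 0) \<in> U"
  and row_space_add: "row_space n E U \<Longrightarrow> u \<in> U \<Longrightarrow> v \<in> U \<Longrightarrow> (\<lambda>j. u j + v j) \<in> U"
  and row_space_smult: "row_space n E U \<Longrightarrow> u \<in> U \<Longrightarrow> (\<lambda>j. a * u j) \<in> U"
  by (simp_all add: row_space_def)

lemma row_space_eq:
  assumes "row_space n E U" "u \<in> U" "\<And>e k. e \<in> E \<Longrightarrow> k < n \<Longrightarrow> v (e, k) = u (e, k)"
  shows "v \<in> U"
proof -
  have "\<forall>j\<in>E \<times> {..<n}. v j = u j" using assms(3) by auto
  then show ?thesis using assms(1,2) by (simp add: row_space_def)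
qed

lemma row_space_sum:
  assumes "row_space n E U" "\<And>s. s \<in> S \<Longrightarrow> u s \<in> U"
  shows "(\<lambda>j. \<Sum>s\<in>S. c s * u s j) \<in> U"
  using assms(2)
proof (induction S rule: infinite_finite_induct)
  case (insert s S)
  have "(\<lambda>j. c s * u s j + (\<Sum>s\<in>S. c s * u s j)) \<in> U"
    using insert by (intro row_space_add[OF assms(1)] row_space_smult[OF assms(1)]) auto
  then show ?case using insert by simp
qed (use row_space_zero[OF assms(1)] in auto)

lemma row_space_diff:
  assumes "row_space n E U" "u \<in> U" "v \<in> U"
  shows "(\<lambda>j. u j - v j) \<in> U"
  using row_space_add[OF assms(1,2) row_space_smult[OF assms(1,3), of "- 1"]] by simp

lemma row_representation_interpolate:
  assumes "row_representation n E indep U" "indep B"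
  shows "\<exists>u\<in>U. \<forall>j\<in>B \<times> {..<n}. u j = g j"
  using assms by (simp add: row_representation_def)

text \<open>These rows form an identity matrix on the columns of \<open>B\<close>; they serve as the
  basis dual to those columns.\<close>

lemma row_representation_unit_rows:
  assumes "row_representation n E indep U" "indep B"
  obtains d where "\<And>i. d i \<in> U"
    "\<And>i j. i \<in> B \<times> {..<n} \<Longrightarrow> j \<in> B \<times> {..<n} \<Longrightarrow> d i j = (if j = i then 1 else 0)"
proof -
  have "\<forall>i. \<exists>u. u \<in> U \<and> (\<forall>j\<in>B \<times> {..<n}. u j = (if j = i then 1 else 0))"
    by (intro allI row_representation_interpolate[OF assms, unfolded Bex_def])
  from choice[OF this] show ?thesis using that by blast
qed

lemma row_representation_vanish:
  assumes U: "row_representation n E indep U" and B: "matroid_basis X indep B" "X \<subseteq> E"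
    and u: "u \<in> U" "\<And>e k. e \<in> B \<Longrightarrow> k < n \<Longrightarrow> u (e, k) = 0" and e: "e \<in> X" "k < n"
  shows "u (e, k) = 0"
proof (cases "e \<in> B")
  case True
  then show ?thesis using u e by simp
next
  case False
  then have "B \<subset> insert e B" "insert e B \<subseteq> X" using B e by (auto simp: matroid_basis_def)
  then have "\<not> indep (insert e B)" "indep B" using B by (auto simp: matroid_basis_def)
  moreover have "\<forall>j\<in>B \<times> {..<n}. u j = 0" using u by auto
  moreover have "e \<in> E" using e B by auto
  ultimately show ?thesis using U u e unfolding row_representation_def by blast
qed

text \<open>The difference of the two sides lies in \<open>U\<close> and vanishes on the block of
  \<open>B\<close>, hence on every element that the basis \<open>B\<close> of \<open>X\<close>
  spans.\<close>

lemma row_representation_expand: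
  assumes U: "row_representation n E indep U" and B: "matroid_basis X indep B" "X \<subseteq> E" "finite B"
    and d: "\<And>i. d i \<in> U"
      "\<And>i j. i \<in> B \<times> {..<n} \<Longrightarrow> j \<in> B \<times> {..<n} \<Longrightarrow> d i j = (if j = i then 1 else 0)"
    and u: "u \<in> U" and j: "j \<in> X \<times> {..<n}"
  shows "u j = (\<Sum>i\<in>B \<times> {..<n}. u i * d i j)"
proof -
  let ?v = "\<lambda>j. u j - (\<Sum>i\<in>B \<times> {..<n}. u i * d i j)"
  have rs: "row_space n E U" using U by (simp add: row_representation_def)
  have "?v \<in> U" by (intro row_space_diff[OF rs] row_space_sum[OF rs] u d)
  moreover have "?v (e, k) = 0" if "e \<in> B" "k < n" for e k
  proof -
    have "(\<Sum>i\<in>B \<times> {..<n}. u i * d i (e, k))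
        = (\<Sum>i\<in>B \<times> {..<n}. if i = (e, k) then u i else 0)"
      using that by (intro sum.cong) (auto simp: d)
    then show ?thesis using that B(3) by simp
  qed
  moreover obtain e k where "j = (e, k)" "e \<in> X" "k < n" using j by auto
  ultimately have "?v j = 0" using row_representation_vanish[OF U B(1,2), of ?v] by blast
  then show ?thesis by simp
qed

section \<open>From row spaces to subspaces\<close>

lemma multilinear_of_row_representation:
  fixes U :: "('e \<times> nat \<Rightarrow> 'f::division_ring) set"
  assumes "matroid E indep" and U: "row_representation n E indep U"
  shows "\<exists>V :: 'e \<Rightarrow> 'f vec set. multilinear_representation n E indep V"
proof -
  interpret matroid E indep by fact
  obtain B0 where B0: "matroid_basis E indep B0" by (rule basis_exists)
  then have B0': "indep B0" "finite B0" using finite_indep by (auto simp: matroid_basis_def)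
  define m where "m = n * matroid_rank indep E"
  have m: "m = card (B0 \<times> {..<n})"
    by (simp add: m_def rank_eq_card[OF B0] card_cartesian_product)
  obtain h where h: "bij_betw h {..<m} (B0 \<times> {..<n})"
    using ex_bij_betw_nat_finite[of "B0 \<times> {..<n}"] B0' m by (auto simp: lessThan_atLeast0)
  obtain d0 where d0: "\<And>i. d0 i \<in> U" "\<And>i j. i \<in> B0 \<times> {..<n} \<Longrightarrow> j \<in> B0 \<times> {..<n} \<Longrightarrow>
      d0 i j = (if j = i then 1 else 0)"
    using row_representation_unit_rows[OF U B0'(1)] by blast
  \<comment> \<open>The rows \<open>d0\<close>, ordered by \<open>h\<close>, are the rows of a
    matrix with \<open>m\<close> rows; \<open>a j\<close> is its column at \<open>j\<close>.\<close>
  define a where "a j = vec m (\<lambda>i. d0 (h i) j)" for j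
  define V where "V e = rspan m (\<lambda>k. a (e, k)) {..<n}" for e
  have dim: "has_right_dim m (rspan m a (X \<times> {..<n})) (n * matroid_rank indep X)"
    if X: "X \<subseteq> E" for X
  proof -
    obtain B where B: "matroid_basis X indep B" by (rule basis_exists)
    then have B': "indep B" "finite B" "B \<subseteq> X" using finite_indep by (auto simp: matroid_basis_def)
    let ?J = "B \<times> {..<n}"
    obtain d where d: "\<And>i. d i \<in> U" "\<And>i j. i \<in> ?J \<Longrightarrow> j \<in> ?J \<Longrightarrow> d i j = (if j = i then 1 else 0)"
      using row_representation_unit_rows[OF U B'(1)] by blast
    have "rindep m a ?J"
      unfolding rindep_def
    proof (intro allI impI ballI)
      fix x j assume x: "rlin m a x ?J = 0\<^sub>v m" and j: "j \<in> ?J"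
      have z: "(\<Sum>l\<in>?J. d0 i l * x l) = 0" if i: "i \<in> B0 \<times> {..<n}" for i
      proof -
        obtain p where p: "p < m" "i = h p" using h i by (auto simp: bij_betw_def)
        have "rlin m a x ?J $ p = 0" using x p by simp
        then show ?thesis using p by (simp add: a_def)
      qed
      \<comment> \<open>The row \<open>d j\<close> selects the coordinate \<open>x j\<close>. It is
        a combination of the rows \<open>d0\<close>, each of which annihilates \<open>x\<close> by
        \<open>z\<close>.\<close>
      have "x j = (\<Sum>l\<in>?J. if l = j then x l else 0)" using j B' by simp
      also have "\<dots> = (\<Sum>l\<in>?J. d j l * x l)" using j d by (intro sum.cong) auto
      also have "\<dots> = (\<Sum>l\<in>?J. (\<Sum>i\<in>B0 \<times> {..<n}. d j i * d0 i l) * x l)"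
      proof (intro sum.cong refl)
        fix l assume "l \<in> ?J"
        then have "l \<in> E \<times> {..<n}" using B' X by auto
        from row_representation_expand[OF U B0 order_refl B0'(2) d0 d(1) this, of j]
        show "d j l * x l = (\<Sum>i\<in>B0 \<times> {..<n}. d j i * d0 i l) * x l" by simp
      qed
      also have "\<dots> = (\<Sum>i\<in>B0 \<times> {..<n}. d j i * (\<Sum>l\<in>?J. d0 i l * x l))"
        unfolding sum_distrib_left sum_distrib_right by (subst sum.swap) (simp add: mult.assoc)
      finally show "x j = 0" using z by simp
    qed
    then have "has_right_dim m (rspan m a ?J) (card ?J)"
      using B' by (intro has_right_dim_rspan) (auto simp: a_def)
    moreover have "rspan m a ?J = rspan m a (X \<times> {..<n})"
    proof (intro equalityI rspan_trans)
      fix j assume "j \<in> ?J"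
      then show "a j \<in> rspan m a (X \<times> {..<n})"
        using B' X finite_ground by (intro rspan_base) (auto simp: a_def dest: finite_subset)
    next
      fix j assume j: "j \<in> X \<times> {..<n}"
      show "a j \<in> rspan m a ?J"
      proof (rule rspanI)
        \<comment> \<open>Each matrix row lies in \<open>U\<close> and expands in the rows
          \<open>d\<close> with its values on \<open>B\<close> as coefficients. Read column by
          column, this expresses \<open>a j\<close> through the columns of \<open>B\<close>.\<close>
        show "a j = rlin m a (\<lambda>i. d i j) ?J"
          using row_representation_expand[OF U B X B'(2) d d0(1) j]
          by (intro eq_vecI) (auto simp: a_def rlin_def)
      qed
    qed
    ultimately show ?thesis by (simp add: rank_eq_card[OF B] card_cartesian_product mult.commute)
  qed
  have sum: "subspace_sum m V X = rspan m a (X \<times> {..<n})" if "X \<subseteq> E" for X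
    using that finite_ground by (intro subspace_sum_rspan) (auto simp: V_def dest: finite_subset)
  \<comment> \<open>A non-loop has rank 1, so the rank condition already gives dimension
    \<open>n\<close>; only the index sets \<open>{..<n}\<close> and
    \<open>{e} \<times> {..<n}\<close> have to be matched.\<close>
  have "has_right_dim m (V e) n" if e: "e \<in> E" "indep {e}" for e
  proof -
    have "rspan m a ({e} \<times> {..<n}) = V e"
      unfolding V_def
    proof (intro equalityI rspan_trans)
      fix j assume "j \<in> {e} \<times> {..<n}"
      then obtain k where "j = (e, k)" "k < n" by auto
      then show "a j \<in> rspan m (\<lambda>k. a (e, k)) {..<n}"
        using rspan_base[of "{..<n}" k "\<lambda>k. a (e, k)" m] by (simp add: a_def)
    next
      fix k assume "k \<in> {..<n}"
      then show "a (e, k) \<in> rspan m a ({e} \<times> {..<n})" by (intro rspan_base) (auto simp: a_def)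
    qed
    moreover have "matroid_basis {e} indep {e}" using e by (auto simp: matroid_basis_def)
    ultimately show ?thesis using dim[of "{e}"] e by (simp add: rank_eq_card)
  qed
  then have "multilinear_representation n E indep V"
    unfolding multilinear_representation_def Let_def m_def[symmetric]
    using dim sum by (auto simp: V_def right_subspace_rspan)
  then show ?thesis by blast
qed

section \<open>From subspaces to row spaces\<close>

lemma multilinear_space_rspan:
  fixes V :: "'e \<Rightarrow> 'f::division_ring vec set"
  assumes V: "multilinear_representation n E indep V" and e: "e \<in> E" and n: "n > 0"
    and M: "matroid E indep"
  shows "\<exists>a. (\<forall>k<n. a k \<in> carrier_vec (n * matroid_rank indep E)) \<and>
    V e = rspan (n * matroid_rank indep E) a {..<n}"
proof (cases "indep {e}")
  case True
  then have "has_right_dim (n * matroid_rank indep E) (V e) n"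
    using V e by (simp add: multilinear_representation_def Let_def)
  then show ?thesis by (rule has_right_dimE) blast
next
  \<comment> \<open>For a loop the rank condition makes the space zero, and it is spanned by
    \<open>n\<close> zero vectors. Thus every element contributes a block of exactly
    \<open>n\<close> columns.\<close>
  case False
  interpret matroid E indep by fact
  let ?m = "n * matroid_rank indep E"
  have sub: "right_subspace ?m (V e)"
    and dim: "has_right_dim ?m (subspace_sum ?m V {e}) (n * matroid_rank indep {e})"
    using V e by (auto simp: multilinear_representation_def Let_def)
  have "matroid_basis {e} indep {}"
    using False indep_empty by (auto simp: matroid_basis_def psubset_eq subset_singleton_iff)
  then have "matroid_rank indep {e} = 0" by (simp add: rank_eq_card)
  then have zero: "subspace_sum ?m V {e} \<subseteq> {0\<^sub>v ?m}"
    using dim by (auto elim!: has_right_dimE simp: rspan_def rlin_def zero_vec_def)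
  have "V e \<subseteq> subspace_sum ?m V {e}"
  proof
    fix w assume w: "w \<in> V e"
    then have "w \<in> carrier_vec ?m" using sub by (auto simp: right_subspace_def)
    then have "w = finsum_vec TYPE('f) ?m (\<lambda>_. w) {e}"
      by (intro eq_vecI) (auto simp: index_finsum_vec finsum_vec_insert finsum_vec_empty)
    then show "w \<in> subspace_sum ?m V {e}" using w unfolding subspace_sum_def by blast
  qed
  then have "V e = {0\<^sub>v ?m}" using zero sub by (auto simp: right_subspace_def)
  moreover have "rlin ?m (\<lambda>_. 0\<^sub>v ?m) x {..<n} = (0\<^sub>v ?m :: 'f vec)" for x
    by (intro eq_vecI) (auto simp: rlin_def)
  then have "rspan ?m (\<lambda>_. 0\<^sub>v ?m) {..<n} = {0\<^sub>v ?m :: 'f vec}" by (simp add: rspan_def)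
  ultimately show ?thesis by (intro exI[of _ "\<lambda>_. 0\<^sub>v ?m"]) auto
qed

text \<open>Counting dimensions shows that the columns of an independent set are independent and
  span the columns of its closure. Linear relations between columns hold for every combination of
  rows, which gives the vanishing condition; a left inverse of the square block of a basis gives
  interpolation.\<close>

lemma row_representation_of_multilinear:
  fixes V :: "'e \<Rightarrow> 'f::division_ring vec set"
  assumes M: "matroid E indep" and n: "n > 0" and V: "multilinear_representation n E indep V"
  shows "\<exists>U :: ('e \<times> nat \<Rightarrow> 'f) set. row_representation n E indep U"
proof -
  interpret matroid E indep by fact
  define m where "m = n * matroid_rank indep E"
  have "\<forall>e\<in>E. \<exists>a. (\<forall>k<n. a k \<in> carrier_vec m) \<and> V e = rspan m a {..<n}"
    unfolding m_def using multilinear_space_rspan[OF V _ n M] by blast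
  then obtain b where b: "\<And>e k. e \<in> E \<Longrightarrow> k < n \<Longrightarrow> b e k \<in> carrier_vec m"
    "\<And>e. e \<in> E \<Longrightarrow> V e = rspan m (b e) {..<n}" by metis
  define a where "a = (\<lambda>(e, k). b e k)"
  have a: "a j \<in> carrier_vec m" if "j \<in> E \<times> {..<n}" for j
    using that b by (auto simp: a_def)
  have dim: "has_right_dim m (rspan m a (X \<times> {..<n})) (n * matroid_rank indep X)"
    if X: "X \<subseteq> E" for X
  proof -
    have "subspace_sum m V X = rspan m a (X \<times> {..<n})"
      using X finite_ground by (intro subspace_sum_rspan) (auto simp: a_def b dest: finite_subset)
    then show ?thesis using V X unfolding m_def
      by (auto simp: multilinear_representation_def Let_def)
  qed
  have base: "a j \<in> rspan m a (X \<times> {..<n})" if "X \<subseteq> E" "j \<in> X \<times> {..<n}" for X j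
    using that a finite_ground by (intro rspan_base) (auto dest: finite_subset)
  \<comment> \<open>The columns of \<open>B\<close> span a space whose dimension is their number, so
    they must be independent.\<close>
  have indep_cols: "rindep m a (B \<times> {..<n})" if B: "indep B" for B
  proof -
    have BE: "B \<subseteq> E" "finite B" using B indep_ground finite_indep by auto
    have "matroid_basis B indep B" using B by (auto simp: matroid_basis_def)
    then have "has_right_dim m (rspan m a (B \<times> {..<n})) (card (B \<times> {..<n}))"
      using dim[OF BE(1)] by (simp add: rank_eq_card card_cartesian_product mult.commute)
    then obtain c where c: "\<And>j. j < card (B \<times> {..<n}) \<Longrightarrow> c j \<in> carrier_vec m"
      "rindep m c {..<card (B \<times> {..<n})}"
      "rspan m a (B \<times> {..<n}) = rspan m c {..<card (B \<times> {..<n})}" by (rule has_right_dimE) (rule that)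
    show ?thesis
    proof (rule rindep_of_spanning[OF _ _ _ c(2)])
      show "c j \<in> rspan m a (B \<times> {..<n})" if "j \<in> {..<card (B \<times> {..<n})}" for j
        unfolding c(3) using that by (intro rspan_base c) auto
    qed (use BE in auto)
  qed
  \<comment> \<open>By the same count the columns of \<open>B\<close> are independent and as many as
    the dimension of the span of all columns of \<open>X\<close>, so they span it.\<close>
  have dep_cols: "a j \<in> rspan m a (B \<times> {..<n})"
    if B: "matroid_basis X indep B" and X: "X \<subseteq> E" and j: "j \<in> X \<times> {..<n}" for X B j
  proof -
    have B': "indep B" "finite B" "B \<subseteq> X" using B finite_indep by (auto simp: matroid_basis_def)
    have "has_right_dim m (rspan m a (X \<times> {..<n})) (card (B \<times> {..<n}))"
      using dim[OF X] by (simp add: rank_eq_card[OF B] card_cartesian_product mult.commute)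
    then obtain c where "\<And>j. j < card (B \<times> {..<n}) \<Longrightarrow> c j \<in> carrier_vec m"
      "rindep m c {..<card (B \<times> {..<n})}"
      and c: "rspan m a (X \<times> {..<n}) = rspan m c {..<card (B \<times> {..<n})}" by (rule has_right_dimE) (rule that)
    show ?thesis
    proof (rule rspan_of_rindep[OF _ _ _ indep_cols[OF B'(1)]])
      show "a j \<in> rspan m c {..<card (B \<times> {..<n})}" using base[OF X j] by (simp only: c)
      show "a l \<in> rspan m c {..<card (B \<times> {..<n})}" if "l \<in> B \<times> {..<n}" for l
        unfolding c[symmetric] using that B' by (intro base[OF X]) auto
    qed (use B' in auto)
  qed
  define row where "row y j = (\<Sum>i<m. y i * a j $ i)" for y j
  define U where "U = {u. \<exists>y. \<forall>j\<in>E \<times> {..<n}. u j = row y j}"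
  have "row_space n E U"
    unfolding row_space_def
  proof (intro conjI ballI allI impI)
    show "(\<lambda>_. 0) \<in> U" unfolding U_def by (auto simp: row_def intro!: exI[of _ "\<lambda>_. 0"])
  next
    fix u v assume "u \<in> U" "v \<in> U"
    then obtain y z where "\<forall>j\<in>E \<times> {..<n}. u j = row y j" "\<forall>j\<in>E \<times> {..<n}. v j = row z j"
      by (auto simp: U_def)
    then have "\<forall>j\<in>E \<times> {..<n}. u j + v j = row (\<lambda>i. y i + z i) j"
      by (simp add: row_def distrib_right sum.distrib)
    then show "(\<lambda>j. u j + v j) \<in> U" unfolding U_def by blast
  next
    fix u and c :: 'f assume "u \<in> U"
    then obtain y where "\<forall>j\<in>E \<times> {..<n}. u j = row y j" by (auto simp: U_def)
    then have "\<forall>j\<in>E \<times> {..<n}. c * u j = row (\<lambda>i. c * y i) j"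
      by (simp add: row_def sum_distrib_left mult.assoc)
    then show "(\<lambda>j. c * u j) \<in> U" unfolding U_def by blast
  next
    fix u v assume "u \<in> U" "\<forall>j\<in>E \<times> {..<n}. v j = u j"
    then show "v \<in> U" by (simp add: U_def)
  qed
  moreover have "\<exists>u\<in>U. \<forall>j\<in>B \<times> {..<n}. u j = g j" if B: "indep B" for B g
  proof -
    \<comment> \<open>Enlarging \<open>B\<close> to a basis of the matroid makes the block of
      columns square, so that it has a left inverse.\<close>
    obtain B0 where B0: "matroid_basis E indep B0" by (rule basis_exists)
    obtain B' where B': "matroid_basis E indep B'" "B \<subseteq> B'" "B' \<subseteq> B \<union> B0"
      using B B0 by (rule extend_to_basis)
    then have B'': "indep B'" "B' \<subseteq> E" "finite B'" using finite_indep by (auto simp: matroid_basis_def)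
    let ?J = "B' \<times> {..<n}"
    have card: "card ?J = m" by (simp add: m_def rank_eq_card[OF B'(1)] card_cartesian_product)
    have fin: "finite ?J" and aJ: "\<And>j. j \<in> ?J \<Longrightarrow> a j \<in> carrier_vec m" using B'' a by auto
    obtain y where y: "\<And>j l. j \<in> ?J \<Longrightarrow> l \<in> ?J \<Longrightarrow>
        (\<Sum>i<m. y j i * a l $ i) = (if j = l then 1 else 0)"
      by (rule rindep_left_inverse[OF fin card _ indep_cols[OF B''(1)]]) (rule aJ, assumption, rule that)
    \<comment> \<open>Row \<open>j\<close> of the left inverse produces the unit row at
      \<open>j\<close>; the values \<open>g j\<close> are then the coefficients to take.\<close>
    have "row (\<lambda>i. \<Sum>j\<in>?J. g j * y j i) l = g l" if l: "l \<in> ?J" for l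
    proof -
      have "row (\<lambda>i. \<Sum>j\<in>?J. g j * y j i) l = (\<Sum>j\<in>?J. g j * (\<Sum>i<m. y j i * a l $ i))"
        unfolding row_def sum_distrib_left sum_distrib_right
        by (subst sum.swap) (simp add: mult.assoc)
      also have "\<dots> = (\<Sum>j\<in>?J. if j = l then g j else 0)"
        using l by (intro sum.cong) (auto simp: y)
      finally show ?thesis using l B'' by simp
    qed
    moreover have "row (\<lambda>i. \<Sum>j\<in>?J. g j * y j i) \<in> U" unfolding U_def by blast
    ultimately show ?thesis using B'(2) by blast
  qed
  moreover have "u (e, k) = 0"
    if B: "indep B" "e \<in> E" "\<not> indep (insert e B)" and u: "u \<in> U" "\<forall>j\<in>B \<times> {..<n}. u j = 0"
      and k: "k < n" for B e u k
  proof -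
    have B': "B \<subseteq> E" using B indep_ground by auto
    obtain y where y: "\<And>j. j \<in> E \<times> {..<n} \<Longrightarrow> u j = row y j" using u by (auto simp: U_def)
    have "matroid_basis (insert e B) indep B"
      unfolding matroid_basis_def
    proof (intro conjI allI impI)
      fix Y assume "B \<subset> Y \<and> Y \<subseteq> insert e B"
      then have "Y = insert e B" by blast
      then show "\<not> indep Y" using B by simp
    qed (use B in auto)
    then have "a (e, k) \<in> rspan m a (B \<times> {..<n})"
      using B B' k by (intro dep_cols[of "insert e B"]) auto
    then obtain x where x: "a (e, k) = rlin m a x (B \<times> {..<n})" by (rule rspanE)
    have "u (e, k) = row y (e, k)" using y B k by auto
    also have "\<dots> = (\<Sum>i<m. y i * (\<Sum>j\<in>B \<times> {..<n}. a j $ i * x j))"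
      by (simp add: row_def x)
    also have "\<dots> = (\<Sum>j\<in>B \<times> {..<n}. row y j * x j)"
      unfolding row_def sum_distrib_left sum_distrib_right
      by (subst sum.swap) (simp add: mult.assoc)
    also have "\<dots> = 0"
    proof (intro sum.neutral ballI)
      fix j assume j: "j \<in> B \<times> {..<n}"
      then have "j \<in> E \<times> {..<n}" using B' by auto
      then show "row y j * x j = 0" using y[of j] u(2) j by simp
    qed
    finally show ?thesis .
  qed
  ultimately have "row_representation n E indep U"
    unfolding row_representation_def by blast
  then show ?thesis by blast
qed

section \<open>Chain groups\<close>

text \<open>The matroid and the chain group are not assumed to be related, since both implications
  between representation and \<open>basis_coordinates\<close> are proved here.\<close>

locale matroid_chain_group = matroid E indep + ring R
  for E :: "'e set" and indep and R :: "'r ring" (structure) +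
  fixes C :: "('e \<Rightarrow> 'r) set"
  assumes chain_group: "chain_group R E C"
begin

declare Units_closed [simp]

lemma chain_closed: "c \<in> C \<Longrightarrow> e \<in> E \<Longrightarrow> c e \<in> carrier R"
  using chain_group by (auto simp: chain_group_def PiE_def Pi_def)

lemma chain_ext:
  assumes "c \<in> C" "d \<in> E \<rightarrow>\<^sub>E X" "\<And>e. e \<in> E \<Longrightarrow> c e = d e"
  shows "c = d"
proof -
  have "c \<in> E \<rightarrow>\<^sub>E carrier R" using assms chain_group by (auto simp: chain_group_def)
  then show ?thesis using assms by (intro PiE_ext) auto
qed

lemma zero_chain_iff:
  assumes "c \<in> C"
  shows "c = zero_chain R E \<longleftrightarrow> (\<forall>e\<in>E. c e = \<zero>)"
proof
  assume "\<forall>e\<in>E. c e = \<zero>"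
  then show "c = zero_chain R E"
    by (intro chain_ext[OF assms, of _ UNIV]) (auto simp: zero_chain_def)
qed (auto simp: zero_chain_def)

lemma smult_chain_mem: "r \<in> carrier R \<Longrightarrow> c \<in> C \<Longrightarrow> smult_chain R E r c \<in> C"
  using chain_group by (simp add: chain_group_def)

lemma chain_eliminate:
  assumes "c \<in> C" "d \<in> C" "r \<in> carrier R"
  obtains g where "g \<in> C" "\<And>e. e \<in> E \<Longrightarrow> g e = c e \<ominus> r \<otimes> d e"
proof
  show "add_chain R E c (smult_chain R E (\<ominus> r) d) \<in> C"
    using assms chain_group by (simp add: chain_group_def)
  show "add_chain R E c (smult_chain R E (\<ominus> r) d) e = c e \<ominus> r \<otimes> d e" if "e \<in> E" for e
    using that assms chain_closed by (simp add: add_chain_def smult_chain_def minus_eq l_minus)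
qed

lemma eq_of_minus_zero: "a \<in> carrier R \<Longrightarrow> b \<in> carrier R \<Longrightarrow> a \<ominus> b = \<zero> \<Longrightarrow> a = b"
  using minus_equality[of a "\<ominus> b"] by (simp add: minus_eq)

lemma unit_mult_zero:
  assumes "u \<in> Units R" "r \<in> carrier R" "r \<otimes> u = \<zero>"
  shows "r = \<zero>"
  using assms m_assoc[of r u "inv u"] by simp

text \<open>The factor \<open>r\<close> need not be a unit. It is nonzero, however, and a nonzero
  element times a unit is nonzero, so multiplying by \<open>r\<close> keeps the support.\<close>

lemma primitive_of_elementary:
  assumes P: "pfield_chain_group (R, Units R) E C" and c: "elementary_chain R E C c"
  obtains d where "d \<in> C" "\<And>e. e \<in> E \<Longrightarrow> d e \<in> Units R \<or> d e = \<zero>"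
    "chain_support R E d = chain_support R E c"
proof -
  obtain r d where r: "r \<in> carrier R" and d: "d \<in> C" "primitive_chain R (Units R) E d"
    and eq: "c = smult_chain R E r d"
    using P c by (auto simp: pfield_chain_group_def)
  have unit: "d e \<in> Units R \<or> d e = \<zero>" if "e \<in> E" for e
    using d that by (auto simp: primitive_chain_def)
  have ce: "c e = r \<otimes> d e" if "e \<in> E" for e using that by (simp add: eq smult_chain_def)
  have "c \<in> C" "c \<noteq> zero_chain R E" using c by (auto simp: elementary_chain_def)
  then obtain f where "f \<in> E" "c f \<noteq> \<zero>" by (auto simp: zero_chain_iff)
  then have "r \<noteq> \<zero>" using ce[of f] chain_closed[OF d(1)] by auto
  then have "c e = \<zero> \<longleftrightarrow> d e = \<zero>" if "e \<in> E" for e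
    using ce[OF that] unit[OF that] unit_mult_zero[OF _ r] r by auto
  then have "chain_support R E d = chain_support R E c" by (auto simp: chain_support_def)
  then show ?thesis using d(1) unit by (intro that)
qed

text \<open>Induction on the size of the support. If a smaller nonzero chain \<open>g\<close> avoids
  \<open>e\<close>, a primitive chain \<open>p\<close> supported within \<open>g\<close> has a unit
  entry at some \<open>f\<close>. Eliminating \<open>f\<close> from \<open>c\<close> by
  \<open>p\<close> shrinks the support and leaves the entry at \<open>e\<close> unchanged.\<close>

lemma elementary_below:
  assumes P: "pfield_chain_group (R, Units R) E C" and c: "c \<in> C" "e \<in> chain_support R E c"
  obtains d where "elementary_chain R E C d" "e \<in> chain_support R E d"
    "chain_support R E d \<subseteq> chain_support R E c"
proof -
  let ?S = "chain_support R E"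
  have "\<exists>d. elementary_chain R E C d \<and> e \<in> ?S d \<and> ?S d \<subseteq> ?S c"
    using c
  proof (induction "card (?S c)" arbitrary: c rule: less_induct)
    case less
    have fin: "finite (?S c)" using finite_ground by (simp add: chain_support_def)
    show ?case
    proof (cases "elementary_chain R E C c")
      case True
      then show ?thesis using less by blast
    next
      case False
      have "c \<noteq> zero_chain R E" using less by (auto simp: chain_support_def zero_chain_def)
      then obtain g where g: "g \<in> C" "g \<noteq> zero_chain R E" "?S g \<subset> ?S c"
        using False less by (auto simp: elementary_chain_def)
      show ?thesis
      proof (cases "e \<in> ?S g")
        case True
        have "card (?S g) < card (?S c)" using fin g(3) by (rule psubset_card_mono)
        then obtain d where "elementary_chain R E C d" "e \<in> ?S d" "?S d \<subseteq> ?S g"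
          using less.hyps[OF _ g(1) True] by blast
        then show ?thesis using g by blast
      next
        case False
        \<comment> \<open>A nonzero chain of least support size within the support of
          \<open>g\<close> is elementary.\<close>
        let ?Q = "\<lambda>d. d \<in> C \<and> d \<noteq> zero_chain R E \<and> ?S d \<subseteq> ?S g"
        have "\<exists>d. ?Q d \<and> (\<forall>x. ?Q x \<longrightarrow> card (?S d) \<le> card (?S x))"
          by (rule ex_has_least_nat[where P = ?Q and m = "\<lambda>x. card (?S x)"]) (use g in auto)
        then obtain h where h: "?Q h" and min: "\<forall>x. ?Q x \<longrightarrow> card (?S h) \<le> card (?S x)"
          by blast
        have "elementary_chain R E C h"
          unfolding elementary_chain_def
        proof (intro conjI notI)
          assume "\<exists>d\<in>C. d \<noteq> zero_chain R E \<and> ?S d \<subset> ?S h"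
          then obtain d where d: "d \<in> C" "d \<noteq> zero_chain R E" "?S d \<subset> ?S h" by blast
          then have "?Q d" using h by blast
          moreover have "card (?S d) < card (?S h)"
            using d(3) finite_ground by (intro psubset_card_mono) (auto simp: chain_support_def)
          ultimately show False using min by fastforce
        qed (use h in auto)
        then obtain p where p: "p \<in> C" "\<And>e. e \<in> E \<Longrightarrow> p e \<in> Units R \<or> p e = \<zero>" "?S p = ?S h"
          using P primitive_of_elementary by metis
        obtain f where f: "f \<in> E" "h f \<noteq> \<zero>" using h zero_chain_iff by auto
        then have fS: "f \<in> ?S p" by (simp add: p(3)) (simp add: chain_support_def)
        then have unit: "p f \<in> Units R" using p(2)[of f] f by (auto simp: chain_support_def)
        have r: "c f \<otimes> inv (p f) \<in> carrier R" using unit chain_closed less f by auto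
        obtain q where q: "q \<in> C" "\<And>x. x \<in> E \<Longrightarrow> q x = c x \<ominus> (c f \<otimes> inv (p f)) \<otimes> p x"
          using chain_eliminate[OF less.prems(1) p(1) r] by blast
        have qf: "q f = \<zero>"
          using q(2)[OF f(1)] unit chain_closed[OF less.prems(1) f(1)]
          by (simp add: m_assoc r_neg minus_eq)
        have qx: "q x = c x" if "x \<in> E" "p x = \<zero>" for x
          using q(2)[OF that(1)] that(2) r chain_closed[OF less.prems(1) that(1)]
          by (simp add: minus_eq)
        have sub: "?S p \<subseteq> ?S c" "e \<notin> ?S p" using h g False p(3) by blast+
        have eE: "e \<in> E" using less.prems by (simp add: chain_support_def)
        have "e \<in> ?S q" using qx[OF eE] sub(2) eE less.prems by (simp add: chain_support_def)
        have "?S q \<subset> ?S c"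
        proof
          show "?S q \<subseteq> ?S c"
          proof
            fix x assume x: "x \<in> ?S q"
            then have xE: "x \<in> E" "q x \<noteq> \<zero>" by (auto simp: chain_support_def)
            show "x \<in> ?S c"
            proof (cases "p x = \<zero>")
              case True
              then show ?thesis using qx[OF xE(1)] xE by (simp add: chain_support_def)
            next
              case False
              then show ?thesis using sub xE by (auto simp: chain_support_def)
            qed
          qed
          have "f \<in> ?S c" "f \<notin> ?S q" using fS sub qf by (auto simp: chain_support_def)
          then show "?S q \<noteq> ?S c" by blast
        qed
        then have "card (?S q) < card (?S c)" using fin by (intro psubset_card_mono)
        then obtain d where "elementary_chain R E C d" "e \<in> ?S d" "?S d \<subseteq> ?S q"
          using less.hyps[OF _ q(1) \<open>e \<in> ?S q\<close>] by blast
        then show ?thesis using \<open>?S q \<subset> ?S c\<close> by blast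
      qed
    qed
  qed
  then show ?thesis using that by blast
qed

text \<open>These are the conditions of \<open>row_representation\<close> with chains in place of
  rows. Prescribing the value \<open>\<one>\<close> at one element and \<open>\<zero>\<close> at the
  others suffices, because left multiples and sums yield all other values.\<close>

definition basis_coordinates :: bool where
  "basis_coordinates \<longleftrightarrow>
     (\<forall>B b. indep B \<and> b \<in> B \<longrightarrow> (\<exists>d\<in>C. d b = \<one> \<and> (\<forall>x\<in>B - {b}. d x = \<zero>))) \<and>
     (\<forall>B e c. indep B \<and> e \<in> E \<and> \<not> indep (insert e B) \<and> c \<in> C \<and> (\<forall>b\<in>B. c b = \<zero>)
       \<longrightarrow> c e = \<zero>)"

text \<open>For the first condition, take the primitive chain on a fundamental cocircuit of
  \<open>b\<close> and scale it by the inverse of its entry at \<open>b\<close>. For the second, a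
  nonzero entry at \<open>e\<close> would lead to a cocircuit through \<open>e\<close> that avoids
  \<open>B\<close>, contrary to \<open>cocircuit_spans\<close>.\<close>

lemma basis_coordinates_of_representation:
  assumes P: "pfield_chain_group (R, Units R) E C"
    and rep: "matroid_of_chain_group (R, Units R) E C indep"
  shows basis_coordinates
  unfolding basis_coordinates_def
proof (intro conjI allI impI; elim conjE)
  have cocircuits: "cocircuits E indep = chain_support R E ` {c. elementary_chain R E C c}"
    using rep by (simp add: matroid_of_chain_group_def)
  {
    fix B b assume B: "indep B" and b: "b \<in> B"
    obtain B0 where "matroid_basis E indep B0" by (rule basis_exists)
    with B obtain A where A: "matroid_basis E indep A" "B \<subseteq> A" by (rule extend_to_basis)
    then obtain D where D: "D \<in> cocircuits E indep" "D \<inter> A = {b}"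
      using fundamental_cocircuit[OF A(1), of b] b by blast
    then obtain c where c: "elementary_chain R E C c" "D = chain_support R E c"
      unfolding cocircuits by blast
    obtain d where d: "d \<in> C" "\<And>e. e \<in> E \<Longrightarrow> d e \<in> Units R \<or> d e = \<zero>"
      "chain_support R E d = chain_support R E c"
      using P c(1) by (rule primitive_of_elementary) (rule that)
    have AE: "A \<subseteq> E" using A by (simp add: matroid_basis_def)
    have bD: "b \<in> chain_support R E d" using D c d by auto
    then have unit: "d b \<in> Units R" using d(2)[of b] by (auto simp: chain_support_def)
    have "b \<in> E" using bD by (simp add: chain_support_def)
    then have "smult_chain R E (inv (d b)) d b = \<one>" using unit by (simp add: smult_chain_def)
    moreover have "smult_chain R E (inv (d b)) d x = \<zero>" if x: "x \<in> B - {b}" for x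
    proof -
      have "x \<in> E" "x \<notin> chain_support R E d" using x A AE D c d by auto
      then have "d x = \<zero>" by (simp add: chain_support_def)
      then show ?thesis using unit \<open>x \<in> E\<close> by (simp add: smult_chain_def)
    qed
    moreover have "smult_chain R E (inv (d b)) d \<in> C" using unit d by (simp add: smult_chain_mem)
    ultimately show "\<exists>d\<in>C. d b = \<one> \<and> (\<forall>x\<in>B - {b}. d x = \<zero>)" by blast
  }
  {
    fix B e c
    assume B: "indep B" "e \<in> E" "\<not> indep (insert e B)" and c: "c \<in> C" "\<forall>b\<in>B. c b = \<zero>"
    show "c e = \<zero>"
    proof (rule ccontr)
      assume "c e \<noteq> \<zero>"
      then have "e \<in> chain_support R E c" using B by (simp add: chain_support_def)
      with P c(1) obtain d where d: "elementary_chain R E C d" "e \<in> chain_support R E d"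
        "chain_support R E d \<subseteq> chain_support R E c" by (rule elementary_below)
      then have "chain_support R E d \<in> cocircuits E indep" unfolding cocircuits by blast
      moreover have "chain_support R E d \<inter> B = {}" using d c by (auto simp: chain_support_def)
      ultimately show False using cocircuit_spans[OF _ d(2) B(1)] B by blast
    qed
  }
qed

lemma basis_coordinates_unit:
  assumes basis_coordinates "indep B" "b \<in> B"
  obtains d where "d \<in> C" "d b = \<one>" "\<And>x. x \<in> B \<Longrightarrow> x \<noteq> b \<Longrightarrow> d x = \<zero>"
  using assms unfolding basis_coordinates_def by blast

lemma basis_coordinates_dependent:
  assumes basis_coordinates "indep B" "e \<in> E" "\<not> indep (insert e B)" "c \<in> C"
    "\<And>b. b \<in> B \<Longrightarrow> c b = \<zero>"
  shows "c e = \<zero>"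
  using assms unfolding basis_coordinates_def by blast

lemma vanish_on_basis:
  assumes bc: basis_coordinates and B: "matroid_basis E indep B"
    and c: "c \<in> C" "\<And>b. b \<in> B \<Longrightarrow> c b = \<zero>" and e: "e \<in> E"
  shows "c e = \<zero>"
proof (cases "e \<in> B")
  case False
  then have "B \<subset> insert e B" "insert e B \<subseteq> E" using B e by (auto simp: matroid_basis_def)
  then have "\<not> indep (insert e B)" "indep B" using B by (auto simp: matroid_basis_def)
  then show ?thesis using basis_coordinates_dependent[OF bc _ e _ c(1)] c(2) by blast
qed (use c in auto)

text \<open>\<open>d\<close> is a coordinate chain of a basis that meets \<open>D\<close> only in
  \<open>f\<close>. An element outside \<open>D\<close> is spanned by the rest of this basis, since
  otherwise exchanging it for \<open>f\<close> would give a basis avoiding \<open>D\<close>. At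
  \<open>e\<close> in \<open>D\<close>, the coordinate chain \<open>g\<close> of the exchanged basis
  supplies an inverse.\<close>

lemma cocircuit_chain:
  assumes bc: basis_coordinates and D: "D \<in> cocircuits E indep"
  obtains d where "d \<in> C" "\<And>e. e \<in> D \<Longrightarrow> d e \<in> Units R" "\<And>e. e \<in> E - D \<Longrightarrow> d e = \<zero>"
proof -
  obtain B0 where "matroid_basis E indep B0" by (rule basis_exists)
  then obtain f where f: "f \<in> D" using cocircuit_meets_basis[OF D] by blast
  with D obtain B where B: "matroid_basis E indep B" "D \<inter> B = {f}" by (rule cocircuit_basis)
  let ?B = "B - {f}"
  have B': "indep B" "B \<subseteq> E" "finite B" "f \<in> B" "f \<in> E" "indep ?B"
    using B finite_indep indep_subset[of B ?B] by (auto simp: matroid_basis_def)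
  obtain d where d: "d \<in> C" "d f = \<one>" "\<And>x. x \<in> B \<Longrightarrow> x \<noteq> f \<Longrightarrow> d x = \<zero>"
    using bc B'(1,4) by (rule basis_coordinates_unit) (rule that)
  have "d e = \<zero>" if e: "e \<in> E - D" for e
  proof (cases "indep (insert e ?B)")
    case True
    have "e \<in> ?B"
    proof (rule ccontr)
      assume "e \<notin> ?B"
      then have "card B \<le> card (insert e ?B)"
        using card_Suc_Diff1[of B f] B' by simp
      then have "matroid_basis E indep (insert e ?B)"
        using indep_ground[OF True] by (intro basis_of_card[OF B(1) True])
      moreover have "D \<inter> insert e ?B = {}" using e B by blast
      ultimately show False using cocircuit_meets_basis[OF D] by blast
    qed
    then show ?thesis using d by auto
  next
    case False
    have "e \<in> E" using e by simp
    from basis_coordinates_dependent[OF bc B'(6) this False d(1)] show ?thesis using d by auto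
  qed
  moreover have "d e \<in> Units R" if e: "e \<in> D" for e
  proof -
    let ?A = "insert e ?B"
    have A: "matroid_basis E indep ?A" using D e B by (rule cocircuit_exchange)
    have eE: "e \<in> E" "indep ?A" using A by (auto simp: matroid_basis_def)
    obtain g where g: "g \<in> C" "g e = \<one>" "\<And>x. x \<in> ?A \<Longrightarrow> x \<noteq> e \<Longrightarrow> g x = \<zero>"
      using bc eE(2) insertI1 by (rule basis_coordinates_unit) (rule that)
    have eB: "e \<notin> ?B" using B e by blast
    have carr: "d e \<in> carrier R" "g f \<in> carrier R" using d g eE B' chain_closed by auto
    \<comment> \<open>The chain \<open>x\<close> minus the left multiple of \<open>y\<close> by
      \<open>x f'\<close> vanishes on a basis, hence everywhere.\<close>
    have vanish: "x e' \<ominus> x f' \<otimes> y e' = \<zero>"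
      if H: "x \<in> C" "y \<in> C" "matroid_basis E indep (insert f' ?B)" "f' \<in> E" "e' \<in> E" "y f' = \<one>"
        "\<And>z. z \<in> ?B \<Longrightarrow> x z = \<zero>" "\<And>z. z \<in> ?B \<Longrightarrow> y z = \<zero>" for x y e' f'
    proof -
      have xf: "x f' \<in> carrier R" using H chain_closed by auto
      obtain q where q: "q \<in> C" "\<And>z. z \<in> E \<Longrightarrow> q z = x z \<ominus> x f' \<otimes> y z"
        using chain_eliminate[OF H(1,2) xf] by blast
      have qz: "q z = \<zero>" if "z \<in> insert f' ?B" for z
      proof (cases "z = f'")
        case True
        then show ?thesis using q(2)[of f'] H(4,6) xf by (simp add: minus_eq r_neg)
      next
        case False
        then have "z \<in> ?B" "z \<in> E" using that B' by auto
        then show ?thesis using q(2)[of z] H(7,8) xf by (simp add: minus_eq)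
      qed
      have "q e' = \<zero>" by (rule vanish_on_basis[OF bc H(3) q(1) qz H(5)])
      then show ?thesis using q H by simp
    qed
    have dz: "d z = \<zero>" and gz: "g z = \<zero>" if "z \<in> ?B" for z using that d g eB by auto
    have ins: "insert f ?B = B" using B' by auto
    \<comment> \<open>Expressing \<open>g\<close> through \<open>d\<close> and then \<open>d\<close>
      through \<open>g\<close> gives both one-sided inverses, as a noncommutative ring
      requires.\<close>
    have "g e \<ominus> g f \<otimes> d e = \<zero>" using g d eE B' B ins dz gz by (intro vanish) auto
    then have l: "g f \<otimes> d e = \<one>" using g carr eq_of_minus_zero[of \<one> "g f \<otimes> d e"] by simp
    have "d f \<ominus> d e \<otimes> g f = \<zero>" using g d eE B' A dz gz by (intro vanish) auto
    then have "d e \<otimes> g f = \<one>" using d carr eq_of_minus_zero[of \<one> "d e \<otimes> g f"] by simp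
    then show ?thesis using l carr unfolding Units_def by blast
  qed
  ultimately show ?thesis using d(1) that by blast
qed

text \<open>The support of a nonzero chain meets every basis, so it contains a cocircuit; each
  cocircuit is the support of a primitive chain, units being nonzero. Minimality on either side then
  identifies cocircuits with supports of elementary chains.\<close>

lemma representation_of_basis_coordinates:
  assumes bc: basis_coordinates and nontriv: "\<one> \<noteq> \<zero>"
  shows "pfield_chain_group (R, Units R) E C \<and> matroid_of_chain_group (R, Units R) E C indep"
proof -
  let ?S = "chain_support R E"
  have unit_nz: "u \<noteq> \<zero>" if "u \<in> Units R" for u
    using that nontriv unit_mult_zero[of u \<one>] by auto
  have below: "\<exists>D\<in>cocircuits E indep. D \<subseteq> ?S c" if c: "c \<in> C" "c \<noteq> zero_chain R E" for c
  proof -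
    have "?S c \<inter> B \<noteq> {}" if B: "matroid_basis E indep B" for B
    proof
      assume "?S c \<inter> B = {}"
      then have "c b = \<zero>" if "b \<in> B" for b
        using that B by (auto simp: chain_support_def matroid_basis_def)
      then have "\<forall>e\<in>E. c e = \<zero>" using vanish_on_basis[OF bc B c(1)] by blast
      then show False using c zero_chain_iff by blast
    qed
    moreover have "?S c \<subseteq> E" by (auto simp: chain_support_def)
    ultimately obtain D where "D \<in> cocircuits E indep" "D \<subseteq> ?S c"
      using contains_cocircuit[of "?S c"] by blast
    then show ?thesis by blast
  qed
  have chain: "\<exists>d\<in>C. primitive_chain R (Units R) E d \<and> d \<noteq> zero_chain R E \<and> ?S d = D
      \<and> (\<forall>e\<in>D. d e \<in> Units R)" if D: "D \<in> cocircuits E indep" for D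
  proof -
    obtain d where d: "d \<in> C" "\<And>e. e \<in> D \<Longrightarrow> d e \<in> Units R" "\<And>e. e \<in> E - D \<Longrightarrow> d e = \<zero>"
      using bc D by (rule cocircuit_chain) (rule that)
    have S: "?S d = D" using d unit_nz cocircuit_ground[OF D] by (auto simp: chain_support_def)
    obtain B where "matroid_basis E indep B" by (rule basis_exists)
    then obtain f where "f \<in> D" using cocircuit_meets_basis[OF D] by blast
    then have "d \<noteq> zero_chain R E" using S by (auto simp: chain_support_def zero_chain_def)
    moreover have "primitive_chain R (Units R) E d"
      unfolding primitive_chain_def
    proof (rule PiE_I)
      show "d e \<in> Units R \<union> {\<zero>}" if "e \<in> E" for e using d(2,3)[of e] that by blast
      have "d \<in> E \<rightarrow>\<^sub>E carrier R" using d(1) chain_group by (auto simp: chain_group_def)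
      then show "d e = undefined" if "e \<notin> E" for e using that by (rule PiE_arb)
    qed
    ultimately show ?thesis using d S by blast
  qed
  have elem: "?S c \<in> cocircuits E indep" if c: "elementary_chain R E C c" for c
  proof -
    have "c \<in> C" "c \<noteq> zero_chain R E" using c by (auto simp: elementary_chain_def)
    then obtain D where D: "D \<in> cocircuits E indep" "D \<subseteq> ?S c" using below by blast
    then obtain d where "d \<in> C" "d \<noteq> zero_chain R E" "?S d = D" using chain by blast
    then have "D = ?S c" using c D by (auto simp: elementary_chain_def)
    then show ?thesis using D by simp
  qed
  have "\<exists>r\<in>carrier R. \<exists>d\<in>C. primitive_chain R (Units R) E d \<and> c = smult_chain R E r d"
    if c: "elementary_chain R E C c" for c
  proof -
    have c': "c \<in> C" "c \<noteq> zero_chain R E" using c by (auto simp: elementary_chain_def)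
    obtain d where d: "d \<in> C" "primitive_chain R (Units R) E d" "d \<noteq> zero_chain R E"
      "?S d = ?S c" "\<forall>e\<in>?S c. d e \<in> Units R" using chain[OF elem[OF c]] by blast
    obtain f where "f \<in> E" "c f \<noteq> \<zero>" using c' zero_chain_iff by blast
    then have f: "f \<in> ?S c" "f \<in> E" by (auto simp: chain_support_def)
    have unit: "d f \<in> Units R" using d f by blast
    \<comment> \<open>This multiple of \<open>d\<close> cancels the entry of \<open>c\<close> at
      \<open>f\<close>. The difference has strictly smaller support, so it is zero because
      \<open>c\<close> is elementary.\<close>
    let ?r = "c f \<otimes> inv (d f)"
    have r: "?r \<in> carrier R" using unit chain_closed[OF c'(1) f(2)] by simp
    obtain q where q: "q \<in> C" "\<And>x. x \<in> E \<Longrightarrow> q x = c x \<ominus> ?r \<otimes> d x"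
      using chain_eliminate[OF c'(1) d(1) r] by blast
    have qf: "q f = \<zero>"
      using q(2)[OF f(2)] unit chain_closed[OF c'(1) f(2)] by (simp add: m_assoc r_neg minus_eq)
    have "q x = \<zero>" if "x \<in> E" "x \<notin> ?S c" for x
    proof -
      have "c x = \<zero>" "d x = \<zero>" using that d(4) by (auto simp: chain_support_def)
      then show ?thesis using q(2)[OF that(1)] r by (simp add: minus_eq)
    qed
    then have "?S q \<subseteq> ?S c" by (auto simp: chain_support_def)
    moreover have "f \<notin> ?S q" using qf by (simp add: chain_support_def)
    ultimately have "?S q \<subset> ?S c" using f(1) by blast
    then have z: "q = zero_chain R E" using c q(1) by (auto simp: elementary_chain_def)
    have "c x = ?r \<otimes> d x" if x: "x \<in> E" for x
    proof (rule eq_of_minus_zero)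
      show "c x \<in> carrier R" by (rule chain_closed[OF c'(1) x])
      show "?r \<otimes> d x \<in> carrier R" using r chain_closed[OF d(1) x] by (rule m_closed)
      have "q x = \<zero>" using z x by (simp add: zero_chain_def)
      then show "c x \<ominus> ?r \<otimes> d x = \<zero>" using q(2)[OF x] by simp
    qed
    then have "c = smult_chain R E ?r d"
      by (intro chain_ext[OF c'(1), of _ UNIV]) (simp_all add: smult_chain_def)
    then show ?thesis using r d by blast
  qed
  moreover have "cocircuits E indep \<subseteq> ?S ` {c. elementary_chain R E C c}"
  proof
    fix D assume D: "D \<in> cocircuits E indep"
    then obtain d where d: "d \<in> C" "d \<noteq> zero_chain R E" "?S d = D" using chain by blast
    have "elementary_chain R E C d"
      unfolding elementary_chain_def
    proof (intro conjI notI d(1))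
      \<comment> \<open>The support of such a chain would contain a cocircuit properly inside
        \<open>D\<close>.\<close>
      assume "\<exists>c\<in>C. c \<noteq> zero_chain R E \<and> ?S c \<subset> ?S d"
      then obtain c where c: "c \<in> C" "c \<noteq> zero_chain R E" "?S c \<subset> D" using d by blast
      then obtain D' where D': "D' \<in> cocircuits E indep" "D' \<subset> D" using below by blast
      then have "dual_indep E indep D'" using D by (simp add: cocircuits_def circuits_def)
      then show False using D' by (simp add: cocircuits_def circuits_def)
    qed (use d in simp)
    then show "D \<in> ?S ` {c. elementary_chain R E C c}" using d by blast
  qed
  ultimately show ?thesis
    using elem chain_group matroid_axioms
    by (auto simp: pfield_chain_group_def matroid_of_chain_group_def)
qed

end

section \<open>Chain groups over matrix rings\<close>

lemma mat_mult_index: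
  assumes "A \<in> carrier_mat n n" "B \<in> carrier_mat n n" "i < n" "k < n"
  shows "(A * B) $$ (i, k) = (\<Sum>l<n. A $$ (i, l) * B $$ (l, k))"
  using assms by (auto simp: scalar_prod_def lessThan_atLeast0)

text \<open>Padding with zero rows lets a single row be tested for membership in a chain group of
  matrices.\<close>

definition row_chain :: "nat \<Rightarrow> 'e set \<Rightarrow> ('e \<times> nat \<Rightarrow> 'f::zero) \<Rightarrow> 'e \<Rightarrow> 'f mat" where
  "row_chain n E u = (\<lambda>e\<in>E. mat n n (\<lambda>(i, k). if i = 0 then u (e, k) else 0))"

definition chain_row :: "('e \<Rightarrow> 'f mat) \<Rightarrow> nat \<Rightarrow> 'e \<times> nat \<Rightarrow> 'f" where
  "chain_row c i = (\<lambda>(e, k). c e $$ (i, k))"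

text \<open>The elementary matrix whose left multiplication moves row \<open>p\<close> to row 0,
  scales it by \<open>a\<close> and clears the rest.\<close>

definition first_row_mat :: "nat \<Rightarrow> nat \<Rightarrow> 'f::zero \<Rightarrow> 'f mat" where
  "first_row_mat n p a = mat n n (\<lambda>(i, l). if i = 0 \<and> l = p then a else 0)"

lemma first_row_mat_carrier [simp]: "first_row_mat n p a \<in> carrier_mat n n"
  by (simp add: first_row_mat_def)

lemma smult_first_row_mat:
  fixes c :: "'e \<Rightarrow> 'f::division_ring mat"
  assumes c: "\<And>e. e \<in> E \<Longrightarrow> c e \<in> carrier_mat n n" and p: "p < n"
  shows "smult_chain (ring_mat TYPE('f) n ()) E (first_row_mat n p a) c
    = row_chain n E (\<lambda>j. a * chain_row c p j)"
  unfolding smult_chain_def row_chain_def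
proof (rule restrict_ext)
  fix e assume e: "e \<in> E"
  have "first_row_mat n p a * c e
      = mat n n (\<lambda>(i, k). if i = 0 then a * chain_row c p (e, k) else 0)" (is "?l = ?r")
  proof (rule eq_matI)
    fix i k assume "i < dim_row ?r" "k < dim_col ?r"
    then have ik: "i < n" "k < n" by auto
    have "?l $$ (i, k) = (\<Sum>l<n. if l = p then (if i = 0 then a * c e $$ (p, k) else 0) else 0)"
      unfolding mat_mult_index[OF first_row_mat_carrier c[OF e] ik]
      using ik by (intro sum.cong) (auto simp: first_row_mat_def)
    then show "?l $$ (i, k) = ?r $$ (i, k)" using ik p by (simp add: chain_row_def)
  qed (use c[OF e] in \<open>auto simp: first_row_mat_def\<close>)
  then show "first_row_mat n p a \<otimes>\<^bsub>ring_mat TYPE('f) n ()\<^esub> c e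
      = mat n n (\<lambda>(i, k). if i = 0 then a * chain_row c p (e, k) else 0)"
    by (simp add: ring_mat_simps)
qed

text \<open>Multiplying by \<open>first_row_mat\<close> shows that every row of a chain of
  \<open>C\<close> belongs to the row space and that the row space is closed under left scalars.
  Interpolation combines rows of the coordinate chains.\<close>

lemma row_representation_of_basis_coordinates:
  fixes C :: "('e \<Rightarrow> 'f::division_ring mat) set"
  assumes M: "matroid_chain_group E indep (ring_mat TYPE('f) n ()) C" and n: "n > 0"
    and bc: "matroid_chain_group.basis_coordinates E indep (ring_mat TYPE('f) n ()) C"
  shows "row_representation n E indep {u. row_chain n E u \<in> C}"
proof -
  let ?R = "ring_mat TYPE('f) n ()"
  let ?U = "{u. row_chain n E u \<in> C}"
  interpret matroid_chain_group E indep ?R C by fact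
  have closed: "c e \<in> carrier_mat n n" if "c \<in> C" "e \<in> E" for c e
    using chain_closed[OF that] by (simp add: ring_mat_simps)
  have row_mem: "chain_row c p \<in> ?U" if c: "c \<in> C" and p: "p < n" for c p
  proof -
    have "smult_chain ?R E (first_row_mat n p 1) c \<in> C"
      using c by (intro smult_chain_mem) (simp_all add: ring_mat_simps)
    then show ?thesis using smult_first_row_mat[of E c n p 1] closed[OF c] p by simp
  qed
  have "row_space n E ?U"
    unfolding row_space_def
  proof (intro conjI ballI allI impI)
    have "zero_chain ?R E = row_chain n E (\<lambda>_. 0)"
      unfolding zero_chain_def row_chain_def
      by (intro restrict_ext) (auto simp: ring_mat_simps)
    moreover have "zero_chain ?R E \<in> C" using chain_group by (simp add: chain_group_def)
    ultimately show "(\<lambda>_. 0) \<in> ?U" by simp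
  next
    fix u v assume "u \<in> ?U" "v \<in> ?U"
    then have "add_chain ?R E (row_chain n E u) (row_chain n E v) \<in> C"
      using chain_group by (simp add: chain_group_def)
    moreover have "add_chain ?R E (row_chain n E u) (row_chain n E v)
        = row_chain n E (\<lambda>j. u j + v j)"
      unfolding add_chain_def row_chain_def
      by (intro restrict_ext) (auto simp: ring_mat_simps)
    ultimately show "(\<lambda>j. u j + v j) \<in> ?U" by simp
  next
    fix u and a :: 'f assume u: "u \<in> ?U"
    then have "smult_chain ?R E (first_row_mat n 0 a) (row_chain n E u) \<in> C"
      by (intro smult_chain_mem) (simp_all add: ring_mat_simps)
    moreover have "smult_chain ?R E (first_row_mat n 0 a) (row_chain n E u)
        = row_chain n E (\<lambda>j. a * chain_row (row_chain n E u) 0 j)"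
      by (rule smult_first_row_mat) (use n in \<open>auto simp: row_chain_def\<close>)
    moreover have "\<dots> = row_chain n E (\<lambda>j. a * u j)"
      unfolding row_chain_def[of n E "\<lambda>j. a * _ j"]
      by (intro restrict_ext) (auto simp: chain_row_def row_chain_def)
    ultimately show "(\<lambda>j. a * u j) \<in> ?U" by simp
  next
    fix u v :: "'e \<times> nat \<Rightarrow> 'f" assume u: "u \<in> ?U" and eq: "\<forall>j\<in>E \<times> {..<n}. v j = u j"
    have "row_chain n E v = row_chain n E u"
      unfolding row_chain_def using eq by (intro restrict_ext) auto
    then show "v \<in> ?U" using u by simp
  qed
  note rs = this
  moreover have "\<exists>u\<in>?U. \<forall>j\<in>B \<times> {..<n}. u j = g j" if B: "indep B" for B g
  proof -
    have B': "finite B" "B \<subseteq> E" using B finite_indep indep_ground by auto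
    have "\<forall>b\<in>B. \<exists>d\<in>C. d b = 1\<^sub>m n \<and> (\<forall>x\<in>B - {b}. d x = 0\<^sub>m n n)"
      using bc B by (simp add: basis_coordinates_def ring_mat_simps)
    then obtain d where d: "\<And>b. b \<in> B \<Longrightarrow> d b \<in> C" "\<And>b. b \<in> B \<Longrightarrow> d b b = 1\<^sub>m n"
      "\<And>b x. b \<in> B \<Longrightarrow> x \<in> B - {b} \<Longrightarrow> d b x = 0\<^sub>m n n" by metis
    \<comment> \<open>For \<open>s = (b, p)\<close>, row \<open>p\<close> of \<open>d b\<close> is
      on the block of \<open>B\<close> the unit row at \<open>s\<close>.\<close>
    define u where "u j = (\<Sum>s\<in>B \<times> {..<n}. g s * chain_row (d (fst s)) (snd s) j)" for j
    have "u \<in> ?U"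
      unfolding u_def by (intro row_space_sum[OF rs] row_mem d) auto
    moreover have "u j = g j" if j: "j \<in> B \<times> {..<n}" for j
    proof -
      have "u j = (\<Sum>s\<in>B \<times> {..<n}. if s = j then g s else 0)"
        unfolding u_def
      proof (intro sum.cong refl)
        fix s assume s: "s \<in> B \<times> {..<n}"
        obtain b p e k where eq: "s = (b, p)" "j = (e, k)" by (cases s, cases j)
        then have *: "b \<in> B" "e \<in> B" "p < n" "k < n" using s j by auto
        show "g s * chain_row (d (fst s)) (snd s) j = (if s = j then g s else 0)"
        proof (cases "b = e")
          case True
          then show ?thesis using * d(2) by (simp add: eq chain_row_def)
        next
          case False
          then have "d b e = 0\<^sub>m n n" using * d(3) by simp
          then show ?thesis using False * by (simp add: eq chain_row_def)
        qed
      qed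
      then show ?thesis using j B' by simp
    qed
    ultimately show ?thesis by blast
  qed
  moreover have "u (e, k) = 0"
    if B: "indep B" "e \<in> E" "\<not> indep (insert e B)" and u: "u \<in> ?U" "\<forall>j\<in>B \<times> {..<n}. u j = 0"
      and k: "k < n" for B e u k
  proof -
    have mem: "row_chain n E u \<in> C" using u(1) by simp
    have vanish: "row_chain n E u b = \<zero>\<^bsub>?R\<^esub>" if "b \<in> B" for b
      using that u(2) indep_ground[OF B(1)] by (auto simp: row_chain_def ring_mat_simps)
    have "row_chain n E u e = \<zero>\<^bsub>?R\<^esub>"
      by (rule basis_coordinates_dependent[OF bc B mem vanish])
    then have "row_chain n E u e $$ (0, k) = 0" using n k by (simp add: ring_mat_simps)
    then show ?thesis using B n k by (simp add: row_chain_def)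
  qed
  ultimately show ?thesis unfolding row_representation_def by blast
qed

text \<open>Requiring each row separately to lie in \<open>U\<close> gives a chain group, because
  the rows of a matrix product are left combinations of the rows of the right factor.\<close>

lemma basis_coordinates_of_row_representation:
  fixes U :: "('e \<times> nat \<Rightarrow> 'f::division_ring) set"
  assumes M: "matroid E indep" and U: "row_representation n E indep U"
  defines "C \<equiv> {c \<in> E \<rightarrow>\<^sub>E carrier_mat n n. \<forall>p<n. chain_row c p \<in> U}"
  shows "matroid_chain_group E indep (ring_mat TYPE('f) n ()) C"
    and "matroid_chain_group.basis_coordinates E indep (ring_mat TYPE('f) n ()) C"
proof -
  let ?R = "ring_mat TYPE('f) n ()"
  interpret matroid E indep by fact
  interpret R: ring ?R by (rule ring_mat_division_ring)
  have rs: "row_space n E U" using U by (simp add: row_representation_def)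
  have memI: "c \<in> C" if "c \<in> E \<rightarrow>\<^sub>E carrier_mat n n" "\<And>p. p < n \<Longrightarrow> chain_row c p \<in> U" for c
    using that by (simp add: C_def)
  have mat: "c e \<in> carrier_mat n n" if "c \<in> C" "e \<in> E" for c e
    using that by (auto simp: C_def)
  have row: "chain_row c p \<in> U" if "c \<in> C" "p < n" for c p
    using that by (simp add: C_def)
  have "chain_group ?R E C"
    unfolding chain_group_def
  proof (intro conjI ballI)
    show "C \<subseteq> E \<rightarrow>\<^sub>E carrier ?R" by (auto simp: C_def ring_mat_simps)
    show "zero_chain ?R E \<in> C"
    proof (rule memI)
      show "chain_row (zero_chain ?R E) p \<in> U" if "p < n" for p
        by (rule row_space_eq[OF rs row_space_zero[OF rs]])
          (use that in \<open>simp add: chain_row_def zero_chain_def ring_mat_simps\<close>)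
    qed (auto simp: zero_chain_def ring_mat_simps)
  next
    fix c d assume c: "c \<in> C" and d: "d \<in> C"
    show "add_chain ?R E c d \<in> C"
    proof (rule memI)
      show "chain_row (add_chain ?R E c d) p \<in> U" if p: "p < n" for p
      proof (rule row_space_eq[OF rs row_space_add[OF rs row[OF c p] row[OF d p]]])
        fix e k assume e: "e \<in> E" and k: "k < n"
        show "chain_row (add_chain ?R E c d) p (e, k) = chain_row c p (e, k) + chain_row d p (e, k)"
          using mat[OF c e] mat[OF d e] e p k by (simp add: chain_row_def add_chain_def ring_mat_simps)
      qed
    qed (use mat[OF c] mat[OF d] in \<open>auto simp: add_chain_def ring_mat_simps\<close>)
  next
    fix r c assume r: "r \<in> carrier ?R" and c: "c \<in> C"
    have r: "r \<in> carrier_mat n n" using r by (simp add: ring_mat_simps)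
    show "smult_chain ?R E r c \<in> C"
    proof (rule memI)
      show "chain_row (smult_chain ?R E r c) p \<in> U" if p: "p < n" for p
      proof (rule row_space_eq[OF rs row_space_sum[OF rs, of "{..<n}" "chain_row c" "\<lambda>l. r $$ (p, l)"]])
        show "chain_row c l \<in> U" if "l \<in> {..<n}" for l using row[OF c] that by simp
        fix e k assume e: "e \<in> E" and k: "k < n"
        show "chain_row (smult_chain ?R E r c) p (e, k) = (\<Sum>l<n. r $$ (p, l) * chain_row c l (e, k))"
          using mat_mult_index[OF r mat[OF c e] p k] e
          by (simp add: chain_row_def smult_chain_def ring_mat_simps)
      qed
    qed (use r mat[OF c] in \<open>auto simp: smult_chain_def ring_mat_simps\<close>)
  qed
  then show MC: "matroid_chain_group E indep ?R C"
    by (intro matroid_chain_group.intro matroid_chain_group_axioms.intro M R.ring_axioms)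
  have "\<exists>d\<in>C. d b = \<one>\<^bsub>?R\<^esub> \<and> (\<forall>x\<in>B - {b}. d x = \<zero>\<^bsub>?R\<^esub>)" if B: "indep B" "b \<in> B" for B b
  proof -
    have BE: "B \<subseteq> E" using B indep_ground by auto
    obtain w where w: "\<And>i. w i \<in> U" "\<And>i j. i \<in> B \<times> {..<n} \<Longrightarrow> j \<in> B \<times> {..<n} \<Longrightarrow>
        w i j = (if j = i then 1 else 0)"
      using row_representation_unit_rows[OF U B(1)] by blast
    \<comment> \<open>Stacking the \<open>n\<close> unit rows that belong to \<open>b\<close> gives
      the identity matrix at \<open>b\<close> and zero matrices at the other elements of
      \<open>B\<close>.\<close>
    define d where "d = (\<lambda>e\<in>E. mat n n (\<lambda>(p, k). w (b, p) (e, k)))"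
    have "d \<in> C"
    proof (rule memI)
      show "chain_row d p \<in> U" if "p < n" for p
        by (rule row_space_eq[OF rs w(1)[of "(b, p)"]]) (use that in \<open>simp add: chain_row_def d_def\<close>)
    qed (auto simp: d_def)
    moreover have "d b = 1\<^sub>m n" using B BE w(2) by (intro eq_matI) (auto simp: d_def)
    moreover have "d x = 0\<^sub>m n n" if "x \<in> B - {b}" for x
      using that B BE w(2) by (intro eq_matI) (auto simp: d_def)
    ultimately show ?thesis by (auto simp: ring_mat_simps)
  qed
  moreover have "c e = \<zero>\<^bsub>?R\<^esub>"
    if B: "indep B" "e \<in> E" "\<not> indep (insert e B)" and c: "c \<in> C" "\<forall>b\<in>B. c b = \<zero>\<^bsub>?R\<^esub>" for B e c
  proof -
    have "chain_row c p (e, k) = 0" if p: "p < n" and k: "k < n" for p k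
    proof -
      have "\<forall>j\<in>B \<times> {..<n}. chain_row c p j = 0" using c(2) p by (auto simp: chain_row_def ring_mat_simps)
      then show ?thesis using U B row[OF c(1) p] k unfolding row_representation_def by blast
    qed
    then show ?thesis
      using mat[OF c(1) B(2)] by (intro eq_matI) (auto simp: chain_row_def ring_mat_simps)
  qed
  ultimately show "matroid_chain_group.basis_coordinates E indep ?R C"
    unfolding matroid_chain_group.basis_coordinates_def[OF MC] by blast
qed

section \<open>The equivalence of multilinear and chain group representations\<close>

theorem theorem4p3:
  fixes E :: "'e set" and indep :: "'e set \<Rightarrow> bool" and n :: nat
  assumes "matroid E indep" and "n > 0"
  shows "(\<exists>V :: 'e \<Rightarrow> 'f::division_ring vec set. multilinear_representation n E indep V) \<longleftrightarrow>
         representable_over E indep (matrix_skew_pfield TYPE('f) n)"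
proof
  let ?R = "ring_mat TYPE('f) n ()"
  assume "\<exists>V :: 'e \<Rightarrow> 'f vec set. multilinear_representation n E indep V"
  then obtain U :: "('e \<times> nat \<Rightarrow> 'f) set" where U: "row_representation n E indep U"
    using row_representation_of_multilinear[OF assms] by blast
  note C = basis_coordinates_of_row_representation[OF assms(1) U]
  \<comment> \<open>As \<open>n\<close> is positive, the entry at \<open>(0, 0)\<close> exists and
    separates one from zero, so the matrix ring is nontrivial.\<close>
  have "\<one>\<^bsub>?R\<^esub> $$ (0, 0) \<noteq> \<zero>\<^bsub>?R\<^esub> $$ (0, 0)" using assms(2) by (simp add: ring_mat_simps)
  then have "\<one>\<^bsub>?R\<^esub> \<noteq> \<zero>\<^bsub>?R\<^esub>" by metis
  from matroid_chain_group.representation_of_basis_coordinates[OF C this]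
  show "representable_over E indep (matrix_skew_pfield TYPE('f) n)"
    unfolding representable_over_def matrix_skew_pfield_def by blast
next
  let ?R = "ring_mat TYPE('f) n ()"
  assume "representable_over E indep (matrix_skew_pfield TYPE('f) n)"
  then obtain C where C: "pfield_chain_group (?R, Units ?R) E C"
    "matroid_of_chain_group (?R, Units ?R) E C indep"
    by (auto simp: representable_over_def matrix_skew_pfield_def)
  then have "chain_group ?R E C" by (simp add: pfield_chain_group_def)
  then have M: "matroid_chain_group E indep ?R C"
    by (intro matroid_chain_group.intro matroid_chain_group_axioms.intro assms ring_mat_division_ring)
  note matroid_chain_group.basis_coordinates_of_representation[OF M C]
  then have "row_representation n E indep {u. row_chain n E u \<in> C}"
    by (rule row_representation_of_basis_coordinates[OF M assms(2)])
  then show "\<exists>V :: 'e \<Rightarrow> 'f vec set. multilinear_representation n E indep V"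
    by (rule multilinear_of_row_representation[OF assms(1)])
qed

end
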